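(* Let $\mathbb{K}$ be a field of characteristic zero and let $m\in\mathbb{N}$, $m\ge1$. Let $\mathcal{T}_m$ be the T-ideal of $\mathbb{K}\langle X\rangle$ generated by the two polynomials $$[x_1,x_2,x_3][x_4,x_5,x_6]\quad\text{and}\quad [x_1,x_2][x_3,x_4]\cdots[x_{2m+3},x_{2m+4}],$$ and let $\mathfrak{T}_m$ be the set of polynomial identities of $UT_2(G^{(2m)})$ that are linear combinations of products of commutators of length $2$ (i.e. of products of the form $[x_{i_1},x_{i_2}]\cdots[x_{i_{2t-1}},x_{i_{2t}}]$). Then $$T(UT_2(G^{(2m)}))=\mathcal{T}_m+\mathfrak{T}_m,$$ where the right-hand side denotes the T-ideal generated by $\mathcal{T}_m\cup\mathfrak{T}_m$.
   Context: $X=\{x_1,x_2,\dots\}$ is a countably infinite set and $\mathbb{K}\langle X\rangle$ is the free unital associative algebra on $X$. A T-ideal is an ideal of $\mathbb{K}\langle X\rangle$ invariant under all endomorphisms; $T(A)$ is the T-ideal of all polynomial identities of an algebra $A$. Commutators are $[a,b]=ab-ba$ and are left-normed: $[a,b,c]=[[a,b],c]$. $G^{(k)}$ is the (unital) Grassmann algebra of a $k$-dimensional $\mathbb{K}$-vector space, and $UT_2(R)$ is the algebra of $2\times2$ upper triangular matrices over $R$. *)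

theory Defs
  imports "HOL-Analysis.Analysis" "HOL-Library.Poly_Mapping"
begin

section \<open>Unital associative algebras over a field\<close>

locale unital_algebra = vector_space smul
  for smul :: "'k::field \<Rightarrow> 'a::ring_1 \<Rightarrow> 'a" +
  assumes mult_scale_left: "smul a x * y = smul a (x * y)"
    and mult_scale_right: "x * smul a y = smul a (x * y)"

definition commutator :: "'a::ring \<Rightarrow> 'a \<Rightarrow> 'a" where
  "commutator a b = a * b - b * a"

section \<open>The free unital associative algebra\<close>

text \<open>
  Words in the letters \<open>x\<^sub>i\<close>, \<open>i = 0, 1, 2, \<dots>\<close>, form the free monoid under concatenation,
  written additively because the convolution product of \<^theory>\<open>HOL-Library.Poly_Mapping\<close> is
  defined for additive monoids. The free algebra is the monoid algebra of the free monoid.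
\<close>

datatype word = Word (letters: "nat list")

instantiation word :: monoid_add
begin
definition zero_word :: word where "0 = Word []"
definition plus_word :: "word \<Rightarrow> word \<Rightarrow> word" where "v + w = Word (letters v @ letters w)"
instance by standard (simp_all add: zero_word_def plus_word_def)
end

type_synonym 'k free_algebra = "word \<Rightarrow>\<^sub>0 'k"

definition var :: "nat \<Rightarrow> 'k::field free_algebra" where
  "var i = Poly_Mapping.single (Word [i]) 1"

definition fa_scale :: "'k::field \<Rightarrow> 'k free_algebra \<Rightarrow> 'k free_algebra" where
  "fa_scale c f = Poly_Mapping.map ((*) c) f"

lemma lookup_fa_scale [simp]: "Poly_Mapping.lookup (fa_scale c f) w = c * Poly_Mapping.lookup f w"
  by (simp add: fa_scale_def Poly_Mapping.map.rep_eq when_def)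

lemma fa_scale_conv_mult: "fa_scale c f = Poly_Mapping.single 0 c * f"
  by (simp add: fa_scale_def mult_map_scale_conv_mult)

lemma free_algebra_induct [case_names single add]:
  fixes f :: "'k::field free_algebra"
  assumes single: "\<And>w c. P (Poly_Mapping.single w c)" and add: "\<And>f g. P f \<Longrightarrow> P g \<Longrightarrow> P (f + g)"
  shows "P f"
proof (induction f rule: Poly_Mapping.update_induct)
  case const
  then show ?case using single[of 0 0] by simp
next
  case (update f w c)
  have "Poly_Mapping.update w c f = Poly_Mapping.single w c + f"
    using update.hyps
    by (intro poly_mapping_eqI) (auto simp: lookup_update lookup_add lookup_single when_def in_keys_iff)
  then show ?case using single add update.IH by simp
qed

lemma single_0_commute:
  fixes f :: "'k::field free_algebra"
  shows "f * Poly_Mapping.single 0 c = Poly_Mapping.single 0 c * f"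
proof (induction f rule: free_algebra_induct)
  case (single k v)
  then show ?case by (simp add: mult_single mult.commute)
next
  case (add f g)
  then show ?case by (simp add: distrib_left distrib_right)
qed

global_interpretation fa: unital_algebra "fa_scale :: 'k::field \<Rightarrow> 'k free_algebra \<Rightarrow> 'k free_algebra"
proof
  fix a b :: 'k and x y :: "'k free_algebra"
  show "fa_scale a (x + y) = fa_scale a x + fa_scale a y"
    by (simp add: fa_scale_conv_mult distrib_left)
  show "fa_scale (a + b) x = fa_scale a x + fa_scale b x"
    by (simp add: fa_scale_conv_mult distrib_right single_add)
  show "fa_scale a (fa_scale b x) = fa_scale (a * b) x"
    by (simp add: fa_scale_conv_mult mult_single flip: mult.assoc)
  show "fa_scale 1 x = x"
    by (simp add: fa_scale_conv_mult)
  show "fa_scale a x * y = fa_scale a (x * y)"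
    by (simp add: fa_scale_conv_mult mult.assoc)
  show "x * fa_scale a y = fa_scale a (x * y)"
    by (metis fa_scale_conv_mult mult.assoc single_0_commute)
qed

definition endomorphism :: "('k::field free_algebra \<Rightarrow> 'k free_algebra) \<Rightarrow> bool" where
  "endomorphism h \<longleftrightarrow>
     Vector_Spaces.linear fa_scale fa_scale h \<and> h 1 = 1 \<and> (\<forall>f g. h (f * g) = h f * h g)"

definition two_sided_ideal :: "'a::ring_1 set \<Rightarrow> bool" where
  "two_sided_ideal I \<longleftrightarrow>
     0 \<in> I \<and> (\<forall>f\<in>I. \<forall>g\<in>I. f + g \<in> I) \<and> (\<forall>f\<in>I. \<forall>g. g * f \<in> I \<and> f * g \<in> I)"

definition T_ideal :: "'k::field free_algebra set \<Rightarrow> bool" where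
  "T_ideal I \<longleftrightarrow> two_sided_ideal I \<and> (\<forall>h. endomorphism h \<longrightarrow> h ` I \<subseteq> I)"

definition T_ideal_generated :: "'k::field free_algebra set \<Rightarrow> 'k free_algebra set" where
  "T_ideal_generated S = \<Inter>{I. T_ideal I \<and> S \<subseteq> I}"

lemma T_ideal_T_ideal_generated: "T_ideal (T_ideal_generated S)"
  unfolding T_ideal_generated_def T_ideal_def two_sided_ideal_def by blast

section \<open>Polynomial identities\<close>

text \<open>
  \<open>eval smul \<phi> f\<close> substitutes \<open>\<phi> i\<close> for \<open>x\<^sub>i\<close> in \<open>f\<close>. An algebra is given by a subalgebra \<open>A\<close>
  of a ring type together with the scalar multiplication of that type.
\<close>

definition eval :: "('k::field \<Rightarrow> 'a::ring_1 \<Rightarrow> 'a) \<Rightarrow> (nat \<Rightarrow> 'a) \<Rightarrow> 'k free_algebra \<Rightarrow> 'a" where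
  "eval smul \<phi> f =
     (\<Sum>w\<in>Poly_Mapping.keys f. smul (Poly_Mapping.lookup f w) (prod_list (map \<phi> (letters w))))"

definition identities :: "('k::field \<Rightarrow> 'a::ring_1 \<Rightarrow> 'a) \<Rightarrow> 'a set \<Rightarrow> 'k free_algebra set" where
  "identities smul A = {f. \<forall>\<phi>. range \<phi> \<subseteq> A \<longrightarrow> eval smul \<phi> f = 0}"

context unital_algebra
begin

lemma eval_superset:
  assumes "finite W" "Poly_Mapping.keys f \<subseteq> W"
  shows "eval smul \<phi> f = (\<Sum>w\<in>W. smul (Poly_Mapping.lookup f w) (prod_list (map \<phi> (letters w))))"
  unfolding eval_def
  by (rule sum.mono_neutral_left) (use assms in \<open>auto simp: in_keys_iff\<close>)

lemma eval_single: "eval smul \<phi> (Poly_Mapping.single w c) = smul c (prod_list (map \<phi> (letters w)))"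
  by (simp add: eval_def)

lemma eval_var: "eval smul \<phi> (var i) = \<phi> i"
  by (simp add: var_def eval_single)

lemma eval_one: "eval smul \<phi> 1 = 1"
  using eval_single[of \<phi> 0 1, unfolded single_one] by (simp add: zero_word_def)

lemma eval_add: "eval smul \<phi> (f + g) = eval smul \<phi> f + eval smul \<phi> g"
proof -
  let ?W = "Poly_Mapping.keys f \<union> Poly_Mapping.keys g"
  have "eval smul \<phi> h = (\<Sum>w\<in>?W. smul (Poly_Mapping.lookup h w) (prod_list (map \<phi> (letters w))))"
    if "h \<in> {f, g, f + g}" for h
    by (rule eval_superset) (use that keys_add[of f g] in auto)
  then show ?thesis
    by (simp add: lookup_add scale_left_distrib sum.distrib)
qed

lemma eval_scale: "eval smul \<phi> (fa_scale c f) = smul c (eval smul \<phi> f)"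
proof -
  have "eval smul \<phi> (fa_scale c f) = (\<Sum>w\<in>Poly_Mapping.keys f.
      smul (Poly_Mapping.lookup (fa_scale c f) w) (prod_list (map \<phi> (letters w))))"
    by (rule eval_superset) (auto simp: in_keys_iff)
  then show ?thesis
    by (simp add: eval_def scale_sum_right)
qed

lemma eval_mult: "eval smul \<phi> (f * g) = eval smul \<phi> f * eval smul \<phi> g"
proof (induction f rule: free_algebra_induct)
  case (single v a)
  show ?case
  proof (induction g rule: free_algebra_induct)
    case (single w b)
    then show ?case
      by (simp add: mult_single eval_single plus_word_def mult_scale_left mult_scale_right mult.commute)
  next
    case (add g h)
    then show ?case by (simp add: distrib_left eval_add)
  qed
next
  case (add f g)
  then show ?case by (simp add: distrib_right eval_add)
qed

end

section \<open>Grassmann algebras\<close>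

text \<open>
  Elements of \<open>'k grassmann\<close> are the finite linear combinations of the basis monomials
  \<open>e\<^sub>S = e\<^bsub>s\<^sub>1\<^esub> \<dots> e\<^bsub>s\<^sub>r\<^esub>\<close> for \<open>S = {s\<^sub>1 < \<dots> < s\<^sub>r}\<close> a finite set of natural numbers. The product of
  \<open>e\<^sub>T\<close> and \<open>e\<^sub>U\<close> is \<open>0\<close> if \<open>T\<close> and \<open>U\<close> meet, and otherwise \<open>e\<^bsub>T \<union> U\<^esub>\<close> with the sign given by
  the number of transpositions needed to sort the concatenation.
\<close>

definition inversions :: "nat set \<Rightarrow> nat set \<Rightarrow> nat" where
  "inversions T U = card {(t, u). t \<in> T \<and> u \<in> U \<and> u < t}"

typedef (overloaded) ('k::zero) grassmann =
  "{f :: nat set \<Rightarrow> 'k. finite {S. f S \<noteq> 0} \<and> (\<forall>S. f S \<noteq> 0 \<longrightarrow> finite S)}"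
  morphisms gcoeff Abs_grassmann
  by (rule exI[of _ "\<lambda>_. 0"]) simp

setup_lifting type_definition_grassmann

lemma gcoeff_infinite: "infinite S \<Longrightarrow> gcoeff f S = 0"
  using gcoeff[of f] by blast

lemma grassmann_eqI:
  assumes "\<And>S. finite S \<Longrightarrow> gcoeff f S = gcoeff g S"
  shows "f = g"
proof -
  have "gcoeff f S = gcoeff g S" for S
    by (cases "finite S") (simp_all add: assms gcoeff_infinite)
  then have "gcoeff f = gcoeff g" by (rule ext)
  then show ?thesis by (simp add: gcoeff_inject)
qed

definition gconv :: "(nat set \<Rightarrow> 'k::comm_ring_1) \<Rightarrow> (nat set \<Rightarrow> 'k) \<Rightarrow> nat set \<Rightarrow> 'k" where
  "gconv f g S = (\<Sum>T\<in>Pow S. (- 1) ^ inversions T (S - T) * f T * g (S - T))"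

lemma gconv_infinite: "infinite S \<Longrightarrow> gconv f g S = 0"
  by (simp add: gconv_def)

lemma inversions_Un_left:
  assumes "finite T" "finite T'" "finite U" "T \<inter> T' = {}"
  shows "inversions (T \<union> T') U = inversions T U + inversions T' U"
proof -
  have eq: "{(t, u). t \<in> T \<union> T' \<and> u \<in> U \<and> u < t} =
      {(t, u). t \<in> T \<and> u \<in> U \<and> u < t} \<union> {(t, u). t \<in> T' \<and> u \<in> U \<and> u < t}" by auto
  have "finite {(t, u). t \<in> T \<and> u \<in> U \<and> u < t}" "finite {(t, u). t \<in> T' \<and> u \<in> U \<and> u < t}"
    by (rule finite_subset[of _ "T \<times> U"], use assms in auto)
       (rule finite_subset[of _ "T' \<times> U"], use assms in auto)
  then show ?thesis unfolding inversions_def eq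
    by (rule card_Un_disjoint) (use assms in auto)
qed

lemma inversions_Un_right:
  assumes "finite T" "finite U" "finite U'" "U \<inter> U' = {}"
  shows "inversions T (U \<union> U') = inversions T U + inversions T U'"
proof -
  have eq: "{(t, u). t \<in> T \<and> u \<in> U \<union> U' \<and> u < t} =
      {(t, u). t \<in> T \<and> u \<in> U \<and> u < t} \<union> {(t, u). t \<in> T \<and> u \<in> U' \<and> u < t}" by auto
  have "finite {(t, u). t \<in> T \<and> u \<in> U \<and> u < t}" "finite {(t, u). t \<in> T \<and> u \<in> U' \<and> u < t}"
    by (rule finite_subset[of _ "T \<times> U"], use assms in auto)
       (rule finite_subset[of _ "T \<times> U'"], use assms in auto)
  then show ?thesis unfolding inversions_def eq
    by (rule card_Un_disjoint) (use assms in auto)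
qed

lemma gconv_assoc:
  assumes S: "finite S"
  shows "gconv (gconv f g) h S = gconv f (gconv g h) S"
proof -
  let ?s = "\<lambda>T U. (- 1 :: 'a) ^ inversions T U"
  have "gconv (gconv f g) h S = (\<Sum>T\<in>Pow S. \<Sum>U\<in>Pow T.
      ?s T (S - T) * (?s U (T - U) * f U * g (T - U)) * h (S - T))"
    by (simp add: gconv_def sum_distrib_left sum_distrib_right)
  also have "\<dots> = (\<Sum>(T, U)\<in>(SIGMA T:Pow S. Pow T).
      ?s T (S - T) * (?s U (T - U) * f U * g (T - U)) * h (S - T))"
    by (rule sum.Sigma) (use S in \<open>simp_all add: finite_subset\<close>)
  also have "\<dots> = (\<Sum>(U, V)\<in>(SIGMA U:Pow S. Pow (S - U)).
      ?s U (S - U) * f U * (?s V (S - U - V) * g V * h (S - U - V)))"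
  proof (rule sum.reindex_bij_witness[where i = "\<lambda>(U, V). (U \<union> V, U)" and j = "\<lambda>(T, U). (U, T - U)"])
    fix p assume "p \<in> (SIGMA T:Pow S. Pow T)"
    then obtain T U where p: "p = (T, U)" and TU: "T \<subseteq> S" "U \<subseteq> T" by auto
    define V where "V = T - U"
    define W where "W = S - T"
    have fin: "finite U" "finite V" "finite W"
      using finite_subset[OF TU(1) S] finite_subset[OF TU(2)] S by (auto simp: V_def W_def)
    have T: "T = U \<union> V" and SU: "S - U = V \<union> W" and SUV: "S - U - V = W"
      using TU by (auto simp: V_def W_def)
    have disj: "U \<inter> V = {}" "V \<inter> W = {}" using TU by (auto simp: V_def W_def)
    have "?s T W * ?s U V = ?s U (V \<union> W) * ?s V W"
      by (simp add: T inversions_Un_left inversions_Un_right fin disj power_add)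
    then have "?s T W * (?s U V * f U * g V) * h W = ?s U (V \<union> W) * f U * (?s V W * g V * h W)"
      by (metis (no_types, lifting) mult.assoc mult.left_commute)
    then show "(case case p of (T, U) \<Rightarrow> (U, T - U) of (U, V) \<Rightarrow>
          ?s U (S - U) * f U * (?s V (S - U - V) * g V * h (S - U - V))) =
        (case p of (T, U) \<Rightarrow> ?s T (S - T) * (?s U (T - U) * f U * g (T - U)) * h (S - T))"
      using SU SUV by (simp add: p flip: V_def W_def)
  qed auto
  also have "\<dots> = (\<Sum>U\<in>Pow S. \<Sum>V\<in>Pow (S - U).
      ?s U (S - U) * f U * (?s V (S - U - V) * g V * h (S - U - V)))"
    by (rule sum.Sigma[symmetric]) (use S in \<open>simp_all add: finite_subset\<close>)
  also have "\<dots> = gconv f (gconv g h) S"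
    by (simp add: gconv_def sum_distrib_left)
  finally show ?thesis .
qed

instantiation grassmann :: (comm_ring_1) ring_1
begin

lift_definition zero_grassmann :: "'a grassmann" is "\<lambda>_. 0" by simp

lift_definition one_grassmann :: "'a grassmann" is "\<lambda>S. if S = {} then 1 else 0" by simp

lift_definition plus_grassmann :: "'a grassmann \<Rightarrow> 'a grassmann \<Rightarrow> 'a grassmann"
  is "\<lambda>f g S. f S + g S"
proof safe
  fix f g :: "nat set \<Rightarrow> 'a"
  assume "finite {S. f S \<noteq> 0}" "finite {S. g S \<noteq> 0}"
  then show "finite {S. f S + g S \<noteq> 0}"
    by (rule finite_subset[rotated, OF finite_UnI]) auto
next
  fix f g :: "nat set \<Rightarrow> 'a" and S
  assume "\<forall>S. f S \<noteq> 0 \<longrightarrow> finite S" "\<forall>S. g S \<noteq> 0 \<longrightarrow> finite S" "f S + g S \<noteq> 0"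
  then show "finite S" by (metis add.right_neutral)
qed

lift_definition uminus_grassmann :: "'a grassmann \<Rightarrow> 'a grassmann" is "\<lambda>f S. - f S" by simp

definition minus_grassmann :: "'a grassmann \<Rightarrow> 'a grassmann \<Rightarrow> 'a grassmann"
  where "f - g = f + - g" for f :: "'a grassmann"

lift_definition times_grassmann :: "'a grassmann \<Rightarrow> 'a grassmann \<Rightarrow> 'a grassmann" is gconv
proof safe
  fix f g :: "nat set \<Rightarrow> 'a"
  assume fin: "finite {S. f S \<noteq> 0}" "finite {S. g S \<noteq> 0}"
  have "{S. gconv f g S \<noteq> 0} \<subseteq> (\<lambda>(T, U). T \<union> U) ` ({S. f S \<noteq> 0} \<times> {S. g S \<noteq> 0})"
  proof
    fix S assume "S \<in> {S. gconv f g S \<noteq> 0}"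
    then obtain T where T: "T \<in> Pow S" "(- 1) ^ inversions T (S - T) * f T * g (S - T) \<noteq> 0"
      unfolding gconv_def by (auto elim: sum.not_neutral_contains_not_neutral)
    then have "f T \<noteq> 0" "g (S - T) \<noteq> 0" "S = T \<union> (S - T)" by auto
    then show "S \<in> (\<lambda>(T, U). T \<union> U) ` ({S. f S \<noteq> 0} \<times> {S. g S \<noteq> 0})"
      by (intro image_eqI[of _ _ "(T, S - T)"]) auto
  qed
  then show "finite {S. gconv f g S \<noteq> 0}"
    by (rule finite_subset) (use fin in auto)
next
  fix f g :: "nat set \<Rightarrow> 'a" and S
  assume "gconv f g S \<noteq> 0"
  then show "finite S" using gconv_infinite by blast
qed

instance
proof
  fix a b c :: "'a grassmann"
  show "a + b + c = a + (b + c)" by transfer (simp add: add.assoc)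
  show "a + b = b + a" by transfer (simp add: add.commute)
  show "0 + a = a" by transfer simp
  show "- a + a = 0" by transfer simp
  show "a - b = a + - b" by (simp add: minus_grassmann_def)
  show "a * b * c = a * (b * c)"
    by (rule grassmann_eqI) (simp add: times_grassmann.rep_eq gconv_assoc)
  show "(a + b) * c = a * c + b * c"
    by (rule grassmann_eqI)
      (simp add: times_grassmann.rep_eq plus_grassmann.rep_eq gconv_def algebra_simps sum.distrib)
  show "a * (b + c) = a * b + a * c"
    by (rule grassmann_eqI)
      (simp add: times_grassmann.rep_eq plus_grassmann.rep_eq gconv_def algebra_simps sum.distrib)
  show "1 * a = a"
  proof (rule grassmann_eqI)
    fix S :: "nat set" assume "finite S"
    then have "gcoeff (1 * a) S = (\<Sum>T\<in>{{}}. (- 1) ^ inversions T (S - T) * gcoeff 1 T * gcoeff a (S - T))"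
      unfolding times_grassmann.rep_eq gconv_def
      by (intro sum.mono_neutral_right) (auto simp: one_grassmann.rep_eq)
    then show "gcoeff (1 * a) S = gcoeff a S" by (simp add: one_grassmann.rep_eq inversions_def)
  qed
  show "a * 1 = a"
  proof (rule grassmann_eqI)
    fix S :: "nat set" assume "finite S"
    then have "gcoeff (a * 1) S = (\<Sum>T\<in>{S}. (- 1) ^ inversions T (S - T) * gcoeff a T * gcoeff 1 (S - T))"
      unfolding times_grassmann.rep_eq gconv_def
      by (intro sum.mono_neutral_right) (auto simp: one_grassmann.rep_eq)
    then show "gcoeff (a * 1) S = gcoeff a S" by (simp add: one_grassmann.rep_eq inversions_def)
  qed
  show "(0 :: 'a grassmann) \<noteq> 1"
  proof
    assume "(0 :: 'a grassmann) = 1"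
    then have "gcoeff (0 :: 'a grassmann) {} = gcoeff 1 {}" by simp
    then show False by (simp add: zero_grassmann.rep_eq one_grassmann.rep_eq)
  qed
qed

end

lift_definition gr_scale :: "'k::field \<Rightarrow> 'k grassmann \<Rightarrow> 'k grassmann" is "\<lambda>c f S. c * f S"
proof -
  fix c :: 'k and f :: "nat set \<Rightarrow> 'k"
  assume f: "finite {S. f S \<noteq> 0} \<and> (\<forall>S. f S \<noteq> 0 \<longrightarrow> finite S)"
  have "{S. c * f S \<noteq> 0} \<subseteq> {S. f S \<noteq> 0}" by auto
  then have "finite {S. c * f S \<noteq> 0}" by (rule finite_subset) (use f in simp)
  then show "finite {S. c * f S \<noteq> 0} \<and> (\<forall>S. c * f S \<noteq> 0 \<longrightarrow> finite S)"
    using f by simp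
qed

global_interpretation gr: unital_algebra "gr_scale :: 'k::field \<Rightarrow> 'k grassmann \<Rightarrow> 'k grassmann"
proof
  fix a b :: 'k and x y :: "'k grassmann"
  show "gr_scale a (x + y) = gr_scale a x + gr_scale a y" by transfer (simp add: distrib_left)
  show "gr_scale (a + b) x = gr_scale a x + gr_scale b x" by transfer (simp add: distrib_right)
  show "gr_scale a (gr_scale b x) = gr_scale (a * b) x" by transfer (simp add: mult.assoc)
  show "gr_scale 1 x = x" by transfer simp
  show "gr_scale a x * y = gr_scale a (x * y)"
    by (transfer fixing: a)
      (auto simp: gconv_def fun_eq_iff sum_distrib_left intro!: sum.cong)
  show "x * gr_scale a y = gr_scale a (x * y)"
    by (transfer fixing: a)
      (auto simp: gconv_def fun_eq_iff sum_distrib_left intro!: sum.cong)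
qed

text \<open>\<open>Grassmann k\<close> is the Grassmann algebra of the vector space with basis \<open>e\<^sub>0, \<dots>, e\<^bsub>k-1\<^esub>\<close>.\<close>

definition Grassmann :: "nat \<Rightarrow> 'k::comm_ring_1 grassmann set" where
  "Grassmann k = {g. \<forall>S. gcoeff g S \<noteq> 0 \<longrightarrow> S \<subseteq> {..<k}}"

text \<open>The defining relations of the exterior algebra hold for the generators \<open>e\<^sub>i\<close>, and the basis
  monomials are the increasing products of generators.\<close>

lift_definition gmon :: "nat set \<Rightarrow> 'k::comm_ring_1 grassmann"
  is "\<lambda>S U. if finite S \<and> U = S then 1 else 0" by auto

lemma gmon_mult:
  assumes "finite T" "finite U"
  shows "gmon T * gmon U = (if T \<inter> U = {} then (- 1) ^ inversions T U * gmon (T \<union> U) else 0)"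
proof (rule grassmann_eqI)
  fix S :: "nat set" assume S: "finite S"
  have sgn: "gcoeff ((- 1) ^ n * a) S = (- 1) ^ n * gcoeff a S" for n and a :: "'a grassmann"
    by (induction n) (simp_all add: uminus_grassmann.rep_eq)
  have "gcoeff (gmon T * gmon U :: 'a grassmann) S =
      (\<Sum>V\<in>Pow S. if V = T \<and> S - V = U then (- 1) ^ inversions T U else 0)"
    unfolding times_grassmann.rep_eq gconv_def gmon.rep_eq using assms by (intro sum.cong) auto
  also have "\<dots> = (\<Sum>V\<in>Pow S. if V = T then (if S - T = U then (- 1) ^ inversions T U else 0) else 0)"
    by (intro sum.cong) auto
  also have "\<dots> = (if T \<subseteq> S \<and> S - T = U then (- 1) ^ inversions T U else 0)"
    using S by (simp add: sum.delta)
  also have "\<dots> = gcoeff (if T \<inter> U = {} then (- 1) ^ inversions T U * gmon (T \<union> U) else 0) S"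
    using assms by (auto simp: sgn gmon.rep_eq zero_grassmann.rep_eq)
  finally show "gcoeff (gmon T * gmon U :: 'a grassmann) S = \<dots>" .
qed

lemma gmon_empty: "gmon {} = 1"
  by transfer auto

lemma generator_square: "gmon {i} * gmon {i} = 0"
  by (simp add: gmon_mult)

lemma generator_anticommute: "gmon {i} * gmon {j} = - (gmon {j} * gmon {i})"
proof -
  have *: "{(t, u). t = i \<and> u = j \<and> u < t} = (if j < i then {(i, j)} else {})" for i j :: nat
    by auto
  show ?thesis
    by (cases i j rule: linorder_cases) (auto simp: gmon_mult inversions_def * insert_commute)
qed

lemma gmon_conv_generators:
  assumes "finite S"
  shows "gmon S = prod_list (map (\<lambda>i. gmon {i}) (sorted_list_of_set S))"
  using assms
proof (induction S rule: finite_linorder_min_induct)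
  case empty
  then show ?case by (simp add: gmon_empty)
next
  case (insert i S)
  have "{(t, u). t \<in> {i} \<and> u \<in> S \<and> u < t} = {}" using insert.hyps by fastforce
  then have inv: "inversions {i} S = 0" unfolding inversions_def by (metis card.empty)
  have "i \<notin> S" using insert.hyps by blast
  then have "gmon {i} * gmon S = (gmon (insert i S) :: 'a grassmann)"
    using insert.hyps inv by (simp add: gmon_mult)
  moreover have "sorted_list_of_set (insert i S) = i # sorted_list_of_set S"
    using insert.hyps \<open>i \<notin> S\<close>
    by (simp add: sorted_list_of_set_insert_remove insort_is_Cons order.strict_implies_order)
  ultimately show ?case using insert.IH by simp
qed

section \<open>Upper triangular matrices\<close>

typedef (overloaded) ('a::zero) ut2 = "{M :: 'a ^ 2 ^ 2. M $ 2 $ 1 = 0}"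
  morphisms mat_of_ut2 Abs_ut2
  by (rule exI[of _ "0"]) simp

setup_lifting type_definition_ut2

instantiation ut2 :: (ring_1) ring_1
begin

lift_definition zero_ut2 :: "'a ut2" is 0 by simp
lift_definition one_ut2 :: "'a ut2" is "mat 1" by (simp add: mat_def)
lift_definition plus_ut2 :: "'a ut2 \<Rightarrow> 'a ut2 \<Rightarrow> 'a ut2" is "(+)" by simp
lift_definition minus_ut2 :: "'a ut2 \<Rightarrow> 'a ut2 \<Rightarrow> 'a ut2" is "(-)" by simp
lift_definition uminus_ut2 :: "'a ut2 \<Rightarrow> 'a ut2" is uminus by simp
lift_definition times_ut2 :: "'a ut2 \<Rightarrow> 'a ut2 \<Rightarrow> 'a ut2" is "(**)"
  by (simp add: matrix_matrix_mult_def sum_2)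

instance
proof
  fix a b c :: "'a ut2"
  show "a + b + c = a + (b + c)" by transfer (simp add: add.assoc)
  show "a + b = b + a" by transfer (simp add: add.commute)
  show "0 + a = a" by transfer simp
  show "- a + a = 0" by transfer simp
  show "a - b = a + - b" by transfer simp
  show "a * b * c = a * (b * c)" by transfer (simp add: matrix_mul_assoc)
  show "1 * a = a" by transfer simp
  show "a * 1 = a" by transfer simp
  show "(a + b) * c = a * c + b * c"
    by transfer (simp add: matrix_matrix_mult_def vec_eq_iff sum_2 algebra_simps)
  show "a * (b + c) = a * b + a * c"
    by transfer (simp add: matrix_matrix_mult_def vec_eq_iff sum_2 algebra_simps)
  show "(0 :: 'a ut2) \<noteq> 1" by transfer (auto simp: mat_def vec_eq_iff)
qed

end

lift_definition ut2_scale :: "'k::field \<Rightarrow> 'k grassmann ut2 \<Rightarrow> 'k grassmann ut2"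
  is "\<lambda>c M. \<chi> i j. gr_scale c (M $ i $ j)"
  by simp

global_interpretation ut2:
  unital_algebra "ut2_scale :: 'k::field \<Rightarrow> 'k grassmann ut2 \<Rightarrow> 'k grassmann ut2"
proof
  fix a b :: 'k and x y :: "'k grassmann ut2"
  show "ut2_scale a (x + y) = ut2_scale a x + ut2_scale a y"
    by transfer (simp add: vec_eq_iff gr.scale_right_distrib)
  show "ut2_scale (a + b) x = ut2_scale a x + ut2_scale b x"
    by transfer (simp add: vec_eq_iff gr.scale_left_distrib)
  show "ut2_scale a (ut2_scale b x) = ut2_scale (a * b) x"
    by transfer (simp add: vec_eq_iff)
  show "ut2_scale 1 x = x" by transfer (simp add: vec_eq_iff)
  show "ut2_scale a x * y = ut2_scale a (x * y)"
    by transfer (simp add: vec_eq_iff matrix_matrix_mult_def gr.mult_scale_left gr.scale_sum_right)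
  show "x * ut2_scale a y = ut2_scale a (x * y)"
    by transfer (simp add: vec_eq_iff matrix_matrix_mult_def gr.mult_scale_right gr.scale_sum_right)
qed

definition UT2 :: "'a::ring_1 set \<Rightarrow> 'a ut2 set" where
  "UT2 R = {M. \<forall>i j. mat_of_ut2 M $ i $ j \<in> R}"

definition T_gen :: "nat \<Rightarrow> 'k::field free_algebra set" where
  "T_gen m = T_ideal_generated
     {commutator (commutator (var 1) (var 2)) (var 3) * commutator (commutator (var 4) (var 5)) (var 6),
      prod_list (map (\<lambda>i. commutator (var (2 * i + 1)) (var (2 * i + 2))) [0..<m + 2])}"

text \<open>Products are non-empty. Admitting the empty product \<open>1\<close> would not change the identities in the
  span, since an identity of a unital algebra has zero constant term.\<close>

definition commutator_products :: "'k::field free_algebra set" where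
  "commutator_products =
     {prod_list (map (\<lambda>(i, j). commutator (var i) (var j)) ps) | ps. ps \<noteq> []}"

definition commutator_identities :: "nat \<Rightarrow> 'k::field free_algebra set" where
  "commutator_identities m =
     identities ut2_scale (UT2 (Grassmann (2 * m))) \<inter> fa.span commutator_products"

end

theory Submission
  imports Defs "HOL-Combinatorics.Permutations"
begin

text \<open>
  Write \<open>A\<close> for the algebra \<open>UT2 (Grassmann (2 * m))\<close>, \<open>T\<close> for \<open>T_gen m\<close>, and call a left-normed
  commutator long if its length is at least 3.

  Every element of \<open>T_ideal_generated (T_gen m \<union> commutator_identities m)\<close> is an identity of \<open>A\<close>.
  Commutators in a Grassmann algebra have even degree at least 2 and are central. So a long commutator
  of triangular matrices is strictly triangular and the product of two of them vanishes
  (\<open>long_long_identity\<close>). In a product of \<open>m + 2\<close> commutators all but at most one of the factors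
  contribute a diagonal entry of degree at least 2, which exceeds the available degree \<open>2 * m\<close>
  (\<open>many_commutators_identity\<close>).

  For the converse, characteristic 0 reduces the problem to multilinear identities
  (\<open>multilinearization\<close>), and since \<open>A\<close> is unital, to identities that are linear combinations of
  products of left-normed commutators of length at least 2 (\<open>proper_reduction\<close>). Modulo \<open>T\<close> such
  a product is zero, a product of commutators of length 2, or a product with exactly one long
  factor \<open>L\<close>, that is \<open>P * L * Q\<close> where \<open>P\<close> and \<open>Q\<close> are products of commutators of length 2. In the
  last case \<open>P\<close> and \<open>Q\<close> are alternating in their letters modulo an ideal that is annihilated by
  long commutators, and \<open>L\<close> can be put into the form \<open>[x\<^sub>i, x\<^sub>\<mu>, \<dots>]\<close> with \<open>\<mu>\<close> the least of its letters
  and the rest increasing, up to products with a shorter long factor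
  (\<open>proper_subset_normal_span\<close>).

  It remains to see that the coefficients of these normal forms are determined by the values of the
  polynomial on \<open>A\<close>. Let \<open>C\<close>, \<open>R\<close>, \<open>D\<close> be the letters of \<open>P\<close>, \<open>L\<close>, \<open>Q\<close>. Substitute independent
  generators of the Grassmann algebra in the upper left corner for the letters in \<open>C\<close>, and in the
  lower right corner for those in \<open>D\<close>, the matrix unit \<open>E\<^sub>1\<^sub>2\<close> for \<open>x\<^sub>i\<close>, and \<open>E\<^sub>1\<^sub>1\<close> for the remaining
  letters of \<open>R\<close>. The latter commute with everything that is diagonal here, so a product survives
  only if all of \<open>R\<close> lies in the one factor that contains \<open>x\<^sub>i\<close>. This kills every product of commutators of
  length 2, and every other normal form whose long factor has at most as many letters as \<open>L\<close>
  (locale \<open>separating_point\<close>). If some coefficient were nonzero, choosing one for which \<open>L\<close> is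
  longest would thus give a contradiction (\<open>normal_form_coefficients_zero\<close>). Hence an identity
  that is a combination of products of commutators is congruent modulo \<open>T\<close> to a combination of products
  of commutators of length 2, which is then an identity itself (\<open>proper_identity\<close>).
\<close>

section \<open>Ideals and T-ideals of the free algebra\<close>

lemma ideal_zero: "two_sided_ideal I \<Longrightarrow> 0 \<in> I"
  and ideal_add: "two_sided_ideal I \<Longrightarrow> f \<in> I \<Longrightarrow> g \<in> I \<Longrightarrow> f + g \<in> I"
  and ideal_mult_left: "two_sided_ideal I \<Longrightarrow> f \<in> I \<Longrightarrow> g * f \<in> I"
  and ideal_mult_right: "two_sided_ideal I \<Longrightarrow> f \<in> I \<Longrightarrow> f * g \<in> I"
  by (auto simp: two_sided_ideal_def)

lemma ideal_uminus: "two_sided_ideal I \<Longrightarrow> f \<in> I \<Longrightarrow> - f \<in> I"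
  using ideal_mult_left[of I f "- 1"] by simp

lemma ideal_diff: "two_sided_ideal I \<Longrightarrow> f \<in> I \<Longrightarrow> g \<in> I \<Longrightarrow> f - g \<in> I"
  using ideal_add[of I f "- g"] ideal_uminus[of I g] by simp

lemma ideal_sum: "two_sided_ideal I \<Longrightarrow> (\<And>x. x \<in> X \<Longrightarrow> f x \<in> I) \<Longrightarrow> sum f X \<in> I"
  by (induction X rule: infinite_finite_induct) (auto intro: ideal_zero ideal_add)

lemma ideal_commutator: "two_sided_ideal I \<Longrightarrow> f \<in> I \<Longrightarrow> commutator f g \<in> I"
  unfolding commutator_def by (intro ideal_diff ideal_mult_left ideal_mult_right)

lemma ideal_scale: "two_sided_ideal I \<Longrightarrow> f \<in> I \<Longrightarrow> fa_scale c f \<in> I"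
  by (simp add: fa_scale_conv_mult ideal_mult_left)

lemma subspace_ideal: "two_sided_ideal I \<Longrightarrow> fa.subspace I"
  by (auto simp: fa.subspace_def ideal_zero ideal_add ideal_scale)

abbreviation subst :: "(nat \<Rightarrow> 'k::field free_algebra) \<Rightarrow> 'k free_algebra \<Rightarrow> 'k free_algebra" where
  "subst \<equiv> eval fa_scale"

lemma (in unital_algebra) eval_zero: "eval smul \<phi> 0 = 0"
  by (simp add: eval_def)

lemma (in unital_algebra) eval_diff: "eval smul \<phi> (f - g) = eval smul \<phi> f - eval smul \<phi> g"
  by (metis add_diff_cancel diff_add_cancel eval_add)

lemma (in unital_algebra) eval_sum: "eval smul \<phi> (sum F X) = (\<Sum>x\<in>X. eval smul \<phi> (F x))"
  by (induction X rule: infinite_finite_induct) (auto simp: eval_zero eval_add)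

lemma (in unital_algebra) eval_commutator:
  "eval smul \<phi> (commutator f g) = commutator (eval smul \<phi> f) (eval smul \<phi> g)"
  by (simp add: commutator_def eval_diff eval_mult)

lemma (in unital_algebra) eval_prod_list:
  "eval smul \<phi> (prod_list fs) = prod_list (map (eval smul \<phi>) fs)"
  by (induction fs) (auto simp: eval_one eval_mult)

lemma (in unital_algebra) eval_in_subalgebra:
  assumes "0 \<in> A" "1 \<in> A" "\<And>a b. a \<in> A \<Longrightarrow> b \<in> A \<Longrightarrow> a + b \<in> A"
    "\<And>a b. a \<in> A \<Longrightarrow> b \<in> A \<Longrightarrow> a * b \<in> A" "\<And>c a. a \<in> A \<Longrightarrow> smul c a \<in> A" "\<And>i. \<phi> i \<in> A"
  shows "eval smul \<phi> f \<in> A"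
proof -
  have p: "prod_list (map \<phi> l) \<in> A" for l
    by (induction l) (simp_all add: assms)
  have s: "sum F X \<in> A" if "\<And>x. x \<in> X \<Longrightarrow> F x \<in> A" for F :: "word \<Rightarrow> 'a" and X
    using that by (induction X rule: infinite_finite_induct) (simp_all add: assms)
  show ?thesis
    unfolding eval_def by (intro s assms(5) p)
qed

lemma endomorphism_subst: "endomorphism (subst \<sigma>)"
  unfolding endomorphism_def
  by (auto simp: fa.eval_one fa.eval_mult fa.eval_add fa.eval_scale
      Vector_Spaces.linear_def module_hom_def module_hom_axioms_def fa.vector_space_axioms fa.module_axioms)

lemma T_ideal_subst: "T_ideal I \<Longrightarrow> f \<in> I \<Longrightarrow> subst \<sigma> f \<in> I"
  unfolding T_ideal_def using endomorphism_subst by blast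

lemma prod_vars: "prod_list (map var l) = Poly_Mapping.single (Word l) (1::'k::field)"
  by (induction l) (simp_all add: var_def mult_single plus_word_def flip: zero_word_def)

lemma single_conv_vars:
  "Poly_Mapping.single w c = fa_scale c (prod_list (map var (letters w)))"
  by (intro poly_mapping_eqI) (auto simp: prod_vars lookup_single when_def)

lemma eval_endomorphism:
  assumes "unital_algebra smul" "endomorphism h"
  shows "eval smul \<phi> (h f) = eval smul (\<lambda>i. eval smul \<phi> (h (var i))) f"
proof -
  interpret A: unital_algebra smul by fact
  interpret h: Vector_Spaces.linear fa_scale fa_scale h
    using assms(2) by (simp add: endomorphism_def)
  have h1: "h 1 = 1" and hm: "\<And>f g. h (f * g) = h f * h g"
    using assms(2) by (auto simp: endomorphism_def)
  have hp: "h (prod_list (map var l)) = prod_list (map (\<lambda>i. h (var i)) l)" for l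
    by (induction l) (auto simp: h1 hm)
  show ?thesis
  proof (induction f rule: free_algebra_induct)
    case (single w c)
    show ?case
      by (simp add: A.eval_single single_conv_vars h.scale hp A.eval_scale A.eval_prod_list o_def)
         (simp add: A.eval_var)
  next
    case (add f g)
    then show ?case by (simp add: A.eval_add h.add)
  qed
qed

section \<open>Multilinearization\<close>

lift_definition restrict_words :: "(nat list \<Rightarrow> bool) \<Rightarrow> 'k::field free_algebra \<Rightarrow> 'k free_algebra"
  is "\<lambda>P f w. if P (letters w) then f w else 0"
  by (rule finite_subset[rotated]) auto

text \<open>
  \<open>f\<close> minus its image under \<open>x\<^sub>j \<mapsto> 0\<close> is the part of \<open>f\<close> supported on the words that contain \<open>x\<^sub>j\<close>;
  repeating this for all \<open>j \<in> S\<close> stays inside a T-ideal. Applied to a polynomial of degree at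
  most \<open>card S\<close> in the letters of \<open>S\<close>, this extracts its multilinear part.
\<close>

lemma restrict_words_containing_all:
  fixes f :: "'k::field free_algebra"
  assumes T: "T_ideal T" and f: "f \<in> T" and S: "finite S"
  shows "restrict_words (\<lambda>z. S \<subseteq> set z) f \<in> T"
  using S
proof (induction S rule: finite_induct)
  case empty
  have "restrict_words (\<lambda>z. {} \<subseteq> set z) f = f"
    by (intro poly_mapping_eqI) (simp add: restrict_words.rep_eq)
  then show ?case using f by simp
next
  case (insert j S)
  define kill :: "nat \<Rightarrow> 'k free_algebra" where "kill = (\<lambda>i. if i = j then 0 else var i)"
  have kill_word: "prod_list (map kill z) = (if j \<in> set z then 0 else prod_list (map var z))" for z
    by (induction z) (auto simp: kill_def)
  have kill: "subst kill g = restrict_words (\<lambda>z. j \<notin> set z) g" for g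
  proof (induction g rule: free_algebra_induct)
    case (single w c)
    show ?case
      by (intro poly_mapping_eqI)
        (auto simp: fa.eval_single kill_word prod_vars restrict_words.rep_eq lookup_single when_def)
  next
    case (add f g)
    then show ?case
      by (intro poly_mapping_eqI)
        (simp add: fa.eval_add restrict_words.rep_eq lookup_add)
  qed
  let ?g = "restrict_words (\<lambda>z. S \<subseteq> set z) f"
  have "restrict_words (\<lambda>z. insert j S \<subseteq> set z) f = ?g - subst kill ?g"
    by (intro poly_mapping_eqI) (auto simp: kill restrict_words.rep_eq lookup_minus)
  then show ?case
    using insert.IH T by (simp add: T_ideal_subst ideal_diff T_ideal_def)
qed

text \<open>
  Polarization along a word \<open>w\<close> introduces a new letter for each position of \<open>w\<close> and replaces every
  letter by the sum over the positions at which it occurs.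
\<close>

definition polarize :: "nat list \<Rightarrow> nat \<Rightarrow> 'k::field free_algebra" where
  "polarize w i = (\<Sum>j\<in>{j. j < length w \<and> w ! j = i}. var j)"

lemma lookup_var_mult:
  fixes p :: "'k::field free_algebra"
  shows "Poly_Mapping.lookup (var j * p) (Word z) =
    (case z of [] \<Rightarrow> 0 | i # z' \<Rightarrow> if i = j then Poly_Mapping.lookup p (Word z') else 0)"
proof (induction p rule: free_algebra_induct)
  case (single w c)
  then show ?case
    by (cases w) (auto simp: var_def mult_single lookup_single when_def plus_word_def split: list.split)
next
  case (add f g)
  then show ?case by (auto simp: distrib_left lookup_add split: list.split)
qed

text \<open>
  Expanding the product of sums: each word \<open>u\<close> turns into the sum of the words \<open>z\<close> of positions that
  spell \<open>u\<close> when read through \<open>w\<close>.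
\<close>

lemma lookup_polarize:
  fixes f :: "'k::field free_algebra"
  shows "Poly_Mapping.lookup (subst (polarize w) f) (Word z) =
    (if set z \<subseteq> {..<length w} then Poly_Mapping.lookup f (Word (map ((!) w) z)) else 0)"
proof (induction f rule: free_algebra_induct)
  case (single u c)
  have "Poly_Mapping.lookup (prod_list (map (polarize w) l)) (Word z) =
    (if set z \<subseteq> {..<length w} \<and> map ((!) w) z = l then 1 else 0 :: 'k)" for l
  proof (induction l arbitrary: z)
    case Nil
    show ?case by (auto simp: lookup_one zero_word_def when_def)
  next
    case (Cons i l)
    have "Poly_Mapping.lookup (prod_list (map (polarize w) (i # l))) (Word z) =
      (\<Sum>j\<in>{j. j < length w \<and> w ! j = i}. Poly_Mapping.lookup (var j * prod_list (map (polarize w) l)) (Word z) :: 'k)"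
      by (simp add: polarize_def sum_distrib_right lookup_sum)
    also have "\<dots> = (if set z \<subseteq> {..<length w} \<and> map ((!) w) z = i # l then 1 else 0)"
    proof (cases z)
      case (Cons k z')
      then show ?thesis by (auto simp: lookup_var_mult Cons.IH)
    qed (simp add: lookup_var_mult)
    finally show ?case .
  qed
  then show ?case
    by (cases u) (auto simp: fa.eval_single lookup_single when_def)
next
  case (add f g)
  then show ?case by (simp add: fa.eval_add lookup_add)
qed

lemma lookup_rename:
  fixes f :: "'k::field free_algebra"
  assumes "finite Z" "letters ` Poly_Mapping.keys f \<subseteq> Z"
  shows "Poly_Mapping.lookup (subst (\<lambda>j. var (v j)) f) (Word u) =
    (\<Sum>z\<in>{z\<in>Z. map v z = u}. Poly_Mapping.lookup f (Word z))"
proof -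
  let ?K = "Poly_Mapping.keys f"
  have word: "prod_list (map (\<lambda>j. var (v j)) l) = Poly_Mapping.single (Word (map v l)) (1::'k)" for l
    by (induction l) (simp_all add: var_def mult_single plus_word_def flip: zero_word_def)
  have "Poly_Mapping.lookup (subst (\<lambda>j. var (v j)) f) (Word u) =
    (\<Sum>w\<in>?K. if map v (letters w) = u then Poly_Mapping.lookup f w else 0)"
    unfolding eval_def lookup_sum
    by (rule sum.cong) (auto simp: word lookup_single when_def)
  also have "\<dots> = (\<Sum>w\<in>Word ` Z. if map v (letters w) = u then Poly_Mapping.lookup f w else 0)"
  proof (rule sum.mono_neutral_left)
    show "?K \<subseteq> Word ` Z"
      using assms(2) by (metis image_eqI image_subset_iff subsetI word.collapse)
  qed (use assms(1) in \<open>auto simp: in_keys_iff\<close>)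
  also have "\<dots> = (\<Sum>z\<in>Z. if map v z = u then Poly_Mapping.lookup f (Word z) else 0)"
    by (subst sum.reindex) (auto simp: inj_on_def)
  also have "\<dots> = (\<Sum>z\<in>{z\<in>Z. map v z = u}. Poly_Mapping.lookup f (Word z))"
    using assms(1) by (simp add: sum.inter_filter)
  finally show ?thesis .
qed

text \<open>
  Undoing the polarization multiplies the coefficient of a word \<open>u\<close> by the number of ways to label its
  letters bijectively by positions of \<open>w\<close>. A permutation carrying \<open>w\<close> to \<open>u\<close> shows that this number is
  the same for all rearrangements \<open>u\<close> of \<open>w\<close>.
\<close>

lemma card_labellings_cong:
  fixes u w :: "nat list"
  assumes "mset u = mset w"
  shows "card {z. mset z = mset [0..<length w] \<and> map ((!) w) z = u}
       = card {z. mset z = mset [0..<length w] \<and> map ((!) w) z = w}"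
proof -
  obtain p where p: "p permutes {..<length w}" "permute_list p w = u"
    using assms by (metis mset_eq_permutation)
  have q: "inv p permutes {..<length w}" using p(1) by (rule permutes_inv)
  have len: "length z = length w" if "mset z = mset [0..<length w]" for z
    using that by (metis length_upt mset_eq_length minus_nat.diff_0)
  have inv1: "permute_list (inv p) (permute_list p z) = z" "permute_list p (permute_list (inv p) z) = z"
    if "length z = length w" for z :: "nat list"
    using permute_list_compose[of "inv p" z p] permute_list_compose[of p z "inv p"] p(1) q that
    by (simp_all add: permutes_inv_o flip: permute_list_compose)
  have "bij_betw (permute_list p)
     {z. mset z = mset [0..<length w] \<and> map ((!) w) z = w} {z. mset z = mset [0..<length w] \<and> map ((!) w) z = u}"
  proof (rule bij_betw_byWitness[where f' = "permute_list (inv p)"])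
    show "permute_list p ` {z. mset z = mset [0..<length w] \<and> map ((!) w) z = w}
      \<subseteq> {z. mset z = mset [0..<length w] \<and> map ((!) w) z = u}"
    proof (rule image_subsetI)
      fix z assume "z \<in> {z. mset z = mset [0..<length w] \<and> map ((!) w) z = w}"
      then have z: "mset z = mset [0..<length w]" "map ((!) w) z = w" by auto
      have pz: "p permutes {..<length z}" using p(1) len[OF z(1)] by simp
      have "mset (permute_list p z) = mset [0..<length w]"
        using z(1) mset_permute_list[OF pz] by simp
      moreover have "map ((!) w) (permute_list p z) = u"
        using z(2) p(2) permute_list_map[OF pz, of "(!) w"] by simp
      ultimately show "permute_list p z \<in> {z. mset z = mset [0..<length w] \<and> map ((!) w) z = u}" by blast
    qed
    show "permute_list (inv p) ` {z. mset z = mset [0..<length w] \<and> map ((!) w) z = u}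
      \<subseteq> {z. mset z = mset [0..<length w] \<and> map ((!) w) z = w}"
    proof (rule image_subsetI)
      fix z assume "z \<in> {z. mset z = mset [0..<length w] \<and> map ((!) w) z = u}"
      then have z: "mset z = mset [0..<length w]" "map ((!) w) z = u" by auto
      have pz: "inv p permutes {..<length z}" using q len[OF z(1)] by simp
      have "mset (permute_list (inv p) z) = mset [0..<length w]"
        using z(1) mset_permute_list[OF pz] by simp
      moreover have "map ((!) w) (permute_list (inv p) z) = w"
        using z(2) p(2) permute_list_map[OF pz, of "(!) w"] inv1(1)[OF refl] by simp
      ultimately show "permute_list (inv p) z \<in> {z. mset z = mset [0..<length w] \<and> map ((!) w) z = w}" by blast
    qed
  qed (use len inv1 in blast)+
  from bij_betw_same_card[OF this] show ?thesis by (rule sym)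
qed

definition multilinear_in :: "nat set \<Rightarrow> 'k::field free_algebra \<Rightarrow> bool" where
  "multilinear_in W f \<longleftrightarrow> (\<forall>w\<in>Poly_Mapping.keys f. distinct (letters w) \<and> set (letters w) = W)"

text \<open>
  Let \<open>w\<close> be a longest word of \<open>f\<close>. Polarizing \<open>f\<close> along \<open>w\<close> and keeping only the words that use all
  positions gives a multilinear polynomial: a longest word cannot use a position twice without missing
  another one. Identifying the new letters again yields a multiple of the part of \<open>f\<close> that consists of
  the rearrangements of \<open>w\<close>. The multiplicity is a positive integer, hence invertible in
  characteristic 0, and what remains of \<open>f\<close> has fewer words.
\<close>

lemma multilinearization:
  fixes T J :: "'k::field_char_0 free_algebra set"
  assumes T: "T_ideal T" and J: "T_ideal J"
    and multilinear: "\<And>W f. finite W \<Longrightarrow> f \<in> T \<Longrightarrow> multilinear_in W f \<Longrightarrow> f \<in> J"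
    and "f \<in> T"
  shows "f \<in> J"
  using \<open>f \<in> T\<close>
proof (induction "card (Poly_Mapping.keys f)" arbitrary: f rule: less_induct)
  case less
  show ?case
  proof (cases "f = 0")
    case True
    then show ?thesis using J by (simp add: T_ideal_def ideal_zero)
  next
    case False
    then have ne: "Poly_Mapping.keys f \<noteq> {}" by simp
    let ?L = "(\<lambda>u. length (letters u)) ` Poly_Mapping.keys f"
    have "Max ?L \<in> ?L" using ne by (intro Max_in) auto
    then obtain W where W0: "W \<in> Poly_Mapping.keys f" "Max ?L = length (letters W)" by auto
    have W: "W \<in> Poly_Mapping.keys f"
      "\<And>u. u \<in> Poly_Mapping.keys f \<Longrightarrow> length (letters u) \<le> length (letters W)"
      using W0 Max_ge[of ?L] by auto
    (* g is the multilinear polynomial, b the recovered component of f. *)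
    define w where "w = letters W"
    define d where "d = length w"
    define v where "v = (!) w"
    define g where "g = restrict_words (\<lambda>z. {..<d} \<subseteq> set z) (subst (polarize w) f)"
    define Z where "Z = {z. mset z = mset [0..<d]}"
    have Z_iff: "z \<in> Z \<longleftrightarrow> distinct z \<and> set z = {..<d}" for z
    proof
      assume "z \<in> Z"
      then have "mset z = mset [0..<d]" by (simp add: Z_def)
      from mset_eq_setD[OF this] mset_eq_imp_distinct_iff[OF this]
      show "distinct z \<and> set z = {..<d}" by (simp add: atLeast0LessThan)
    next
      assume "distinct z \<and> set z = {..<d}"
      then show "z \<in> Z"
        using set_eq_iff_mset_eq_distinct[of z "[0..<d]"] by (simp add: Z_def atLeast0LessThan)
    qed
    have finZ: "finite Z" unfolding Z_def by (rule mset_eq_finite)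
    have map_v: "mset (map v z) = mset w" if "z \<in> Z" for z
    proof -
      have "mset (map v z) = mset (map v [0..<d])" using that by (simp add: Z_def)
      then show ?thesis by (simp add: v_def d_def map_nth)
    qed
    have g: "Poly_Mapping.lookup g (Word z) = (if z \<in> Z then Poly_Mapping.lookup f (Word (map v z)) else 0)" for z
    proof (cases "set z = {..<d} \<and> Poly_Mapping.lookup f (Word (map v z)) \<noteq> 0")
      case True
      then have "length z \<le> d" using W(2)[of "Word (map v z)"] by (auto simp: in_keys_iff w_def d_def)
      moreover have "card (set z) = d" using True by simp
      ultimately have "distinct z" by (metis card_distinct card_length le_antisym)
      then show ?thesis using True by (simp add: g_def restrict_words.rep_eq lookup_polarize Z_iff d_def v_def)
    next
      case False
      then show ?thesis by (auto simp: g_def restrict_words.rep_eq lookup_polarize Z_iff d_def v_def)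
    qed
    have keys_g: "letters ` Poly_Mapping.keys g \<subseteq> Z"
      using g by (metis (no_types, lifting) image_subset_iff in_keys_iff word.collapse)
    have gT: "g \<in> T"
      unfolding g_def using T less.prems by (intro restrict_words_containing_all T_ideal_subst) auto
    have "g \<in> J"
      by (rule multilinear[of "{..<d}"])
        (use gT keys_g in \<open>auto simp: multilinear_in_def Z_iff\<close>)
    define N where "N = card {z\<in>Z. map v z = w}"
    have "[0..<d] \<in> {z\<in>Z. map v z = w}"
      by (simp add: Z_def v_def d_def map_nth)
    then have N: "of_nat N \<noteq> (0::'k)"
      unfolding N_def using finZ by (auto simp: card_eq_0_iff)
    define b where "b = fa_scale (inverse (of_nat N)) (subst (\<lambda>j. var (v j)) g)"
    have b: "Poly_Mapping.lookup b (Word u) = (if mset u = mset w then Poly_Mapping.lookup f (Word u) else 0)" for u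
    proof -
      have "Poly_Mapping.lookup (subst (\<lambda>j. var (v j)) g) (Word u) = (\<Sum>z\<in>{z\<in>Z. map v z = u}. Poly_Mapping.lookup g (Word z))"
        by (rule lookup_rename[OF finZ keys_g])
      also have "\<dots> = (\<Sum>z\<in>{z\<in>Z. map v z = u}. Poly_Mapping.lookup f (Word u))"
        by (rule sum.cong) (auto simp: g)
      also have "\<dots> = of_nat (card {z\<in>Z. map v z = u}) * Poly_Mapping.lookup f (Word u)" by simp
      also have "\<dots> = (if mset u = mset w then of_nat N * Poly_Mapping.lookup f (Word u) else 0)"
      proof (cases "mset u = mset w")
        case True
        then show ?thesis using card_labellings_cong[OF True] by (simp add: N_def Z_def v_def d_def)
      next
        case False
        then have "{z\<in>Z. map v z = u} = {}" using map_v by auto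
        then show ?thesis using False by (metis card.empty of_nat_0 mult_zero_left)
      qed
      finally show ?thesis using N by (simp add: b_def)
    qed
    have bT: "b \<in> T" and bJ: "b \<in> J"
      unfolding b_def using T J gT \<open>g \<in> J\<close> by (auto intro!: ideal_scale T_ideal_subst simp: T_ideal_def[of T] T_ideal_def[of J])
    have fb: "Poly_Mapping.lookup (f - b) u = (if mset (letters u) = mset w then 0 else Poly_Mapping.lookup f u)" for u
      using b[of "letters u"] by (auto simp: lookup_minus)
    have "Poly_Mapping.keys (f - b) \<subset> Poly_Mapping.keys f"
      using W(1) by (auto simp: in_keys_iff fb w_def psubset_eq set_eq_iff split: if_splits)
    then have "card (Poly_Mapping.keys (f - b)) < card (Poly_Mapping.keys f)"
      by (intro psubset_card_mono) auto
    moreover have "f - b \<in> T" using less.prems bT T by (simp add: T_ideal_def ideal_diff)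
    ultimately have "f - b \<in> J" using less.hyps by blast
    then have "(f - b) + b \<in> J" using bJ J by (metis T_ideal_def ideal_add)
    then show ?thesis by simp
  qed
qed

section \<open>Multilinear polynomials and products of commutators\<close>

definition ad :: "'k::field free_algebra \<Rightarrow> nat list \<Rightarrow> 'k free_algebra" where
  "ad u l = foldl (\<lambda>u i. commutator u (var i)) u l"

definition left_normed :: "nat list \<Rightarrow> 'k::field free_algebra" where
  "left_normed l = ad (var (hd l)) (tl l)"

abbreviation left_normed_product :: "nat list list \<Rightarrow> 'k::field free_algebra" where
  "left_normed_product ls \<equiv> prod_list (map left_normed ls)"

definition commutator_factors :: "nat set \<Rightarrow> nat list list \<Rightarrow> bool" where
  "commutator_factors V ls \<longleftrightarrow> (\<forall>l\<in>set ls. 2 \<le> length l) \<and> distinct (concat ls) \<and> set (concat ls) = V"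

definition proper :: "nat set \<Rightarrow> 'k::field free_algebra set" where
  "proper V = fa.span {left_normed_product ls | ls. commutator_factors V ls}"

lemma ad_simps [simp]: "ad u [] = u" "ad u (x # l) = ad (commutator u (var x)) l"
  "ad u (l @ l') = ad (ad u l) l'"
  by (simp_all add: ad_def)

lemma commutator_add_left: "commutator (u + v) w = commutator u w + commutator v w"
  and commutator_uminus_left: "commutator (- u) w = - commutator u w"
  by (simp_all add: commutator_def algebra_simps)

lemma ad_add: "ad (u + v) l = ad u l + ad v l"
  by (induction l arbitrary: u v) (simp_all add: commutator_add_left)

lemma ad_uminus: "ad (- u) l = - ad u l"
  by (induction l arbitrary: u) (simp_all add: commutator_uminus_left)

lemma ad_diff: "ad (u - v) l = ad u l - ad v l"
  using ad_add[of u "- v"] by (simp add: ad_uminus)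

lemma left_normed_append: "l \<noteq> [] \<Longrightarrow> left_normed (l @ l') = ad (left_normed l) l'"
  by (cases l) (simp_all add: left_normed_def)

lemma (in unital_algebra) eval_left_normed:
  "eval smul \<phi> (left_normed l) = foldl (\<lambda>u i. commutator u (\<phi> i)) (\<phi> (hd l)) (tl l)"
proof -
  have "eval smul \<phi> (ad u l) = foldl (\<lambda>u i. commutator u (\<phi> i)) (eval smul \<phi> u) l" for u l
    by (induction l arbitrary: u) (simp_all add: eval_commutator eval_var)
  then show ?thesis by (simp add: left_normed_def eval_var)
qed

lemma left_normed_is_commutator:
  assumes "2 \<le> length l"
  obtains u v where "left_normed l = (commutator u v :: 'k::field free_algebra)"
proof -
  obtain l' x where l: "l = l' @ [x]" using assms by (cases l rule: rev_cases) auto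
  then have "left_normed l = (commutator (left_normed l') (var x) :: 'k free_algebra)"
    using assms by (cases "l' = []") (simp_all add: left_normed_append)
  then show ?thesis by (rule that)
qed

lemma left_normed_is_long_commutator:
  assumes "3 \<le> length l"
  obtains u v w where "left_normed l = (commutator (commutator u v) w :: 'k::field free_algebra)"
proof -
  obtain l' x where l: "l = l' @ [x]" using assms by (cases l rule: rev_cases) auto
  obtain u v where "left_normed l' = (commutator u v :: 'k free_algebra)"
    by (rule left_normed_is_commutator[of l']) (use l assms in auto)
  then have "left_normed l = commutator (commutator u v) (var x)"
    using assms l by (cases "l' = []") (simp_all add: left_normed_append)
  then show ?thesis by (rule that)
qed

text \<open>
  The set \<open>B\<close> bounds the letters that may appear outside of the commutators. Keeping track of it allows
  a letter smaller than all of \<open>B\<close> to be put in front without destroying the order.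
\<close>

definition monomials_times_commutators :: "nat set \<Rightarrow> nat set \<Rightarrow> 'k::field free_algebra set" where
  "monomials_times_commutators B V = fa.span {prod_list (map var t) * left_normed_product ls | t ls.
     sorted_wrt (<) t \<and> set t \<subseteq> B \<and> set t \<subseteq> V \<and> commutator_factors (V - set t) ls}"

lemma monomials_times_commutators_mono:
  "B \<subseteq> B' \<Longrightarrow> f \<in> monomials_times_commutators B V \<Longrightarrow> f \<in> monomials_times_commutators B' V"
  unfolding monomials_times_commutators_def
  by (erule rev_subsetD[OF _ fa.span_mono]) blast

lemma smaller_var_times_monomials:
  assumes f: "f \<in> monomials_times_commutators B V" and x: "\<And>b. b \<in> B \<Longrightarrow> x < b" "x \<notin> V"
  shows "var x * f \<in> monomials_times_commutators (insert x B) (insert x V)"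
  using f unfolding monomials_times_commutators_def
proof (induction rule: fa.span_induct_alt)
  case base
  then show ?case by (simp add: fa.span_zero)
next
  case (step c g f)
  then obtain t ls where g: "g = prod_list (map var t) * left_normed_product ls" and t: "sorted_wrt (<) t"
    "set t \<subseteq> B" "set t \<subseteq> V" and ls: "commutator_factors (V - set t) ls" by blast
  have eq: "var x * g = prod_list (map var (x # t)) * left_normed_product ls"
    by (simp add: g mult.assoc)
  have "insert x V - set (x # t) = V - set t" using x(2) by auto
  then have "var x * g \<in> {prod_list (map var t) * left_normed_product ls | t ls.
     sorted_wrt (<) t \<and> set t \<subseteq> insert x B \<and> set t \<subseteq> insert x V \<and> commutator_factors (insert x V - set t) ls}"
    unfolding mem_Collect_eq
    by (intro exI[of _ "x # t"] exI[of _ ls] conjI eq) (use t ls x in auto)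
  then show ?case
    using step.IH by (simp add: distrib_left fa.mult_scale_right fa.span_add fa.span_scale fa.span_base)
qed

text \<open>
  The rule \<open>u * x = x * u + [u, x]\<close> moves a commutator to the right past a letter, at the price of a
  summand in which the commutator has absorbed that letter.
\<close>

lemma commutator_past_monomial:
  assumes "sorted_wrt (<) t" "2 \<le> length l" "distinct (l @ t)" "commutator_factors (V - set (l @ t)) ls"
    "set (l @ t) \<subseteq> V"
  shows "(left_normed l * (prod_list (map var t) * left_normed_product ls) :: 'k::field free_algebra)
    \<in> monomials_times_commutators (set t) V"
  using assms
proof (induction t arbitrary: l V)
  case Nil
  have "commutator_factors (V - set []) (l # ls)"
    using Nil by (auto simp: commutator_factors_def)
  then show ?case
    unfolding monomials_times_commutators_def
    by (intro fa.span_base CollectI exI[of _ "[]"] exI[of _ "l # ls"]) auto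
next
  case (Cons x t)
  let ?R = "prod_list (map var t) * left_normed_product ls :: 'k free_algebra"
  have ne: "l \<noteq> []" using Cons.prems(2) by auto
  have eq: "left_normed l * (prod_list (map var (x # t)) * left_normed_product ls)
    = var x * (left_normed l * ?R) + left_normed (l @ [x]) * ?R"
    using ne by (simp add: left_normed_append commutator_def algebra_simps)
  have "V - {x} - set (l @ t) = V - set (l @ x # t)" by auto
  then have "left_normed l * ?R \<in> monomials_times_commutators (set t) (V - {x})"
    using Cons.prems by (intro Cons.IH) auto
  then have "var x * (left_normed l * ?R) \<in> monomials_times_commutators (insert x (set t)) (insert x (V - {x}))"
    using Cons.prems by (intro smaller_var_times_monomials) auto
  moreover have "insert x (V - {x}) = V" using Cons.prems by auto
  moreover have "left_normed (l @ [x]) * ?R \<in> monomials_times_commutators (set t) V"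
    using Cons.prems by (intro Cons.IH) auto
  then have "left_normed (l @ [x]) * ?R \<in> monomials_times_commutators (insert x (set t)) V"
    by (rule monomials_times_commutators_mono[rotated]) auto
  ultimately show ?case
    unfolding eq by (simp add: monomials_times_commutators_def fa.span_add)
qed

lemma var_past_monomial:
  assumes "sorted_wrt (<) t" "j \<notin> set t" "commutator_factors (V - set (j # t)) ls" "set (j # t) \<subseteq> V"
  shows "(var j * (prod_list (map var t) * left_normed_product ls) :: 'k::field free_algebra)
    \<in> monomials_times_commutators (insert j (set t)) V"
  using assms
proof (induction t arbitrary: V)
  case Nil
  then show ?case
    unfolding monomials_times_commutators_def
    by (intro fa.span_base CollectI exI[of _ "[j]"] exI[of _ ls]) auto
next
  case (Cons x t)
  let ?R = "prod_list (map var t) * left_normed_product ls :: 'k free_algebra"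
  show ?case
  proof (cases "j < x")
    case True
    have eq: "var j * (prod_list (map var (x # t)) * left_normed_product ls)
      = prod_list (map var (j # x # t)) * left_normed_product ls" by (simp add: mult.assoc)
    show ?thesis
      unfolding monomials_times_commutators_def eq
      by (intro fa.span_base CollectI exI[of _ "j # x # t"] exI[of _ ls]) (use Cons.prems True in auto)
  next
    case False
    have eq: "var j * (prod_list (map var (x # t)) * left_normed_product ls)
      = var x * (var j * ?R) + left_normed [j, x] * ?R"
      by (simp add: left_normed_def commutator_def algebra_simps)
    have "V - {x} - set (j # t) = V - set (j # x # t)" by auto
    then have "var j * ?R \<in> monomials_times_commutators (insert j (set t)) (V - {x})"
      using Cons.prems by (intro Cons.IH) auto
    then have "var x * (var j * ?R) \<in> monomials_times_commutators (insert x (insert j (set t))) (insert x (V - {x}))"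
      using Cons.prems False by (intro smaller_var_times_monomials) auto
    moreover have "insert x (V - {x}) = V" using Cons.prems by auto
    moreover have "left_normed [j, x] * ?R \<in> monomials_times_commutators (set t) V"
      using Cons.prems by (intro commutator_past_monomial) (auto simp: strict_sorted_iff)
    then have "left_normed [j, x] * ?R \<in> monomials_times_commutators (insert x (insert j (set t))) V"
      by (rule monomials_times_commutators_mono[rotated]) auto
    ultimately show ?thesis
      unfolding eq by (simp add: monomials_times_commutators_def fa.span_add insert_commute)
  qed
qed

lemma multilinear_word_in_span:
  assumes "distinct l"
  shows "(prod_list (map var l) :: 'k::field free_algebra) \<in> monomials_times_commutators (set l) (set l)"
  using assms
proof (induction l)
  case Nil
  show ?case unfolding monomials_times_commutators_def
    by (intro fa.span_base CollectI exI[of _ "[]"]) (auto simp: commutator_factors_def)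
next
  case (Cons j l)
  have "var j * f \<in> monomials_times_commutators (set (j # l)) (set (j # l))"
    if "f \<in> monomials_times_commutators (set l) (set l)" for f :: "'k free_algebra"
    using that unfolding monomials_times_commutators_def[of "set l" "set l"]
  proof (induction rule: fa.span_induct_alt)
    case base
    then show ?case by (simp add: monomials_times_commutators_def fa.span_zero)
  next
    case (step c g f)
    then obtain t ls where g: "g = prod_list (map var t) * left_normed_product ls" and t: "sorted_wrt (<) t"
      "set t \<subseteq> set l" and ls: "commutator_factors (set l - set t) ls" by blast
    have "set (j # l) - set (j # t) = set l - set t" using Cons.prems by auto
    then have "var j * g \<in> monomials_times_commutators (insert j (set t)) (set (j # l))"
      unfolding g using t ls Cons.prems by (intro var_past_monomial) auto
    then have "var j * g \<in> monomials_times_commutators (set (j # l)) (set (j # l))"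
      by (rule monomials_times_commutators_mono[rotated]) (use t in auto)
    then show ?case
      using step.IH by (simp add: distrib_left fa.mult_scale_right monomials_times_commutators_def fa.span_add fa.span_scale)
  qed
  then show ?case using Cons by simp
qed

abbreviation sorted_monomial :: "nat set \<Rightarrow> 'k::field free_algebra" where
  "sorted_monomial S \<equiv> prod_list (map var (sorted_list_of_set S))"

text \<open>
  The multilinear part of the Poincare-Birkhoff-Witt theorem for the free Lie algebra, as far as
  spanning is concerned.
\<close>

lemma multilinear_decomposition:
  assumes W: "finite W" and f: "multilinear_in W f"
  obtains g where "f = (\<Sum>S\<in>Pow W. sorted_monomial S * g S)" "\<And>S. S \<subseteq> W \<Longrightarrow> g S \<in> proper (W - S)"
proof -
  have "Poly_Mapping.single w (Poly_Mapping.lookup f w) \<in> monomials_times_commutators W W" if "w \<in> Poly_Mapping.keys f" for w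
  proof -
    have "prod_list (map var (letters w)) \<in> monomials_times_commutators W W"
      using f that multilinear_word_in_span[of "letters w"] by (auto simp: multilinear_in_def)
    then show ?thesis
      unfolding monomials_times_commutators_def single_conv_vars by (rule fa.span_scale)
  qed
  then have "(\<Sum>w\<in>Poly_Mapping.keys f. Poly_Mapping.single w (Poly_Mapping.lookup f w)) \<in> monomials_times_commutators W W"
    unfolding monomials_times_commutators_def by (rule fa.span_sum)
  moreover have "(\<Sum>w\<in>Poly_Mapping.keys f. Poly_Mapping.single w (Poly_Mapping.lookup f w)) = f"
    by (intro poly_mapping_eqI) (simp add: lookup_sum lookup_single when_def in_keys_iff)
  ultimately have "f \<in> monomials_times_commutators W W" by simp
  then have "\<exists>g. f = (\<Sum>S\<in>Pow W. sorted_monomial S * g S) \<and> (\<forall>S. S \<subseteq> W \<longrightarrow> g S \<in> proper (W - S))"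
    unfolding monomials_times_commutators_def
  proof (induction rule: fa.span_induct_alt)
    case base
    show ?case by (rule exI[of _ "\<lambda>_. 0"]) (simp add: proper_def fa.span_zero)
  next
    case (step c p f)
    then obtain g where g: "f = (\<Sum>S\<in>Pow W. sorted_monomial S * g S)" "\<And>S. S \<subseteq> W \<Longrightarrow> g S \<in> proper (W - S)"
      by auto
    obtain t ls where p: "p = prod_list (map var t) * left_normed_product ls" and t: "sorted_wrt (<) t"
      "set t \<subseteq> W" and ls: "commutator_factors (W - set t) ls" using step.hyps by blast
    define g' where "g' = (\<lambda>S. (if S = set t then fa_scale c (left_normed_product ls) else 0) + g S)"
    have sl: "sorted_list_of_set (set t) = t"
      using t(1) by (simp add: sorted_list_of_set.idem_if_sorted_distinct strict_sorted_iff)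
    have "(\<Sum>S\<in>Pow W. sorted_monomial S * g' S)
      = (\<Sum>S\<in>Pow W. if S = set t then sorted_monomial S * fa_scale c (left_normed_product ls) else 0) + f"
      unfolding g(1) g'_def sum.distrib[symmetric] by (rule sum.cong) (auto simp: distrib_left)
    also have "\<dots> = fa_scale c p + f"
      using t(2) W by (simp add: sl p fa.mult_scale_right)
    finally have "fa_scale c p + f = (\<Sum>S\<in>Pow W. sorted_monomial S * g' S)" ..
    moreover have "g' S \<in> proper (W - S)" if "S \<subseteq> W" for S
    proof -
      have "left_normed_product ls \<in> proper (W - set t)"
        unfolding proper_def using ls by (intro fa.span_base) auto
      then show ?thesis
        using g(2)[OF that] by (auto simp: g'_def proper_def intro: fa.span_add fa.span_scale)
    qed
    ultimately show ?case by blast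
  qed
  then show ?thesis using that by blast
qed

lemma foldl_commutator_one:
  fixes \<phi> :: "nat \<Rightarrow> 'a::ring_1"
  assumes "\<exists>i\<in>set l. \<phi> i = 1"
  shows "foldl (\<lambda>u i. commutator u (\<phi> i)) x l = 0"
proof -
  have z: "foldl (\<lambda>u i. commutator u (\<phi> i)) 0 l = 0" for l
    by (induction l) (simp_all add: commutator_def)
  show ?thesis using assms
  proof (induction l arbitrary: x)
    case (Cons a l)
    show ?case
    proof (cases "\<phi> a = 1")
      case True
      then have "commutator x (\<phi> a) = 0" by (simp add: commutator_def)
      then show ?thesis by (simp add: z)
    qed (use Cons in auto)
  qed simp
qed

lemma (in unital_algebra) eval_left_normed_one:
  assumes "2 \<le> length l" "\<exists>i\<in>set l. \<phi> i = 1"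
  shows "eval smul \<phi> (left_normed l) = 0"
proof -
  obtain a b l' where l: "l = a # b # l'" using assms(1) by (metis Suc_le_length_iff numeral_2_eq_2)
  show ?thesis
  proof (cases "\<exists>i\<in>set (b # l'). \<phi> i = 1")
    case True
    then show ?thesis using foldl_commutator_one[of "b # l'"] by (simp add: eval_left_normed l)
  next
    case False
    then have "\<phi> a = 1" using assms(2) l by auto
    then have "commutator (\<phi> a) (\<phi> b) = 0" by (simp add: commutator_def)
    moreover have "foldl (\<lambda>u i. commutator u (\<phi> i)) 0 l' = 0"
      by (induction l') (simp_all add: commutator_def)
    ultimately show ?thesis by (simp add: eval_left_normed l)
  qed
qed

text \<open>
  A commutator vanishes as soon as one of its letters is replaced by \<open>1\<close>.
\<close>

lemma proper_subst_one:
  assumes g: "g \<in> proper V"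
  defines "\<sigma> S \<equiv> (\<lambda>i. if i \<in> S then 1 else var i)"
  shows "subst (\<sigma> S) g = (if V \<inter> S = {} then g else 0)"
  using g unfolding proper_def
proof (induction rule: fa.span_induct_alt)
  case base
  then show ?case by (simp add: fa.eval_zero)
next
  case (step c p g)
  then obtain ls where p: "p = left_normed_product ls" and ls: "commutator_factors V ls" by blast
  have "subst (\<sigma> S) p = (if V \<inter> S = {} then p else 0)"
  proof (cases "V \<inter> S = {}")
    case True
    have "subst (\<sigma> S) (left_normed l) = left_normed l" if "l \<in> set ls" for l
    proof -
      have "2 \<le> length l" "set l \<subseteq> V" using ls that by (auto simp: commutator_factors_def)
      then have s: "set (hd l # tl l) \<inter> S = {}" using True by (cases l) auto
      have "foldl (\<lambda>u i. commutator u (\<sigma> S i)) u l' = foldl (\<lambda>u i. commutator u (var i)) u l'"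
        if "set l' \<inter> S = {}" for u l'
        using that by (induction l' arbitrary: u) (simp_all add: \<sigma>_def)
      then show ?thesis
        using s by (simp add: fa.eval_left_normed) (simp add: left_normed_def ad_def \<sigma>_def)
    qed
    then have "map (subst (\<sigma> S)) (map left_normed ls) = map left_normed ls" by simp
    then have "subst (\<sigma> S) p = p" unfolding p fa.eval_prod_list by (simp only:)
    then show ?thesis using True by simp
  next
    case False
    then obtain l i where l: "l \<in> set ls" "i \<in> set l" "i \<in> S" using ls by (auto simp: commutator_factors_def)
    then have "subst (\<sigma> S) (left_normed l) = 0"
      using ls by (intro fa.eval_left_normed_one) (auto simp: commutator_factors_def \<sigma>_def)
    then have "0 \<in> set (map (subst (\<sigma> S)) (map left_normed ls))" using l(1) by force
    moreover have "prod_list xs = 0" if "0 \<in> set xs" for xs :: "'a free_algebra list"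
      using that by (induction xs) auto
    ultimately have "subst (\<sigma> S) p = 0" unfolding p fa.eval_prod_list by blast
    then show ?thesis using False by simp
  qed
  then show ?case using step.IH by (simp add: fa.eval_add fa.eval_scale)
qed

text \<open>
  In \<open>f = (\<Sum>S. sorted_monomial S * g S)\<close>, the substitution \<open>x\<^sub>i \<mapsto> 1\<close> for \<open>i \<in> S\<close> kills all summands
  except those with index \<open>S' \<supseteq> S\<close>, and turns the summand with index \<open>S\<close> into \<open>g S\<close>. So \<open>g S\<close> belongs to
  the T-ideal of \<open>f\<close>, by induction from the larger index sets downwards.
\<close>

lemma proper_reduction:
  fixes T J :: "'k::field free_algebra set"
  assumes T: "T_ideal T" and J: "T_ideal J"
    and proper: "\<And>V g. finite V \<Longrightarrow> g \<in> T \<Longrightarrow> g \<in> proper V \<Longrightarrow> g \<in> J"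
    and W: "finite W" and f: "f \<in> T" "multilinear_in W f"
  shows "f \<in> J"
proof -
  have iT: "two_sided_ideal T" and iJ: "two_sided_ideal J" using T J by (auto simp: T_ideal_def)
  obtain g where fg: "f = (\<Sum>S\<in>Pow W. sorted_monomial S * g S)"
    and g: "\<And>S. S \<subseteq> W \<Longrightarrow> g S \<in> proper (W - S)"
    using multilinear_decomposition[OF W f(2)] by blast
  have gT: "g S \<in> T" if "S \<subseteq> W" for S
    using that
  proof (induction "card (W - S)" arbitrary: S rule: less_induct)
    case less
    define \<sigma> :: "nat \<Rightarrow> 'k free_algebra" where "\<sigma> = (\<lambda>i. if i \<in> S then 1 else var i)"
    have summand: "subst \<sigma> (sorted_monomial S' * g S') \<in> T" if S': "S' \<in> Pow W - {S}" for S'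
    proof (cases "S \<subseteq> S'")
      case True
      then have "W - S' \<subset> W - S" using S' less.prems by auto
      then have "card (W - S') < card (W - S)" using W by (intro psubset_card_mono) auto
      then have "g S' \<in> T" using less.hyps S' by auto
      then show ?thesis using T iT by (intro T_ideal_subst ideal_mult_left)
    next
      case False
      then have "(W - S') \<inter> S \<noteq> {}" using less.prems by auto
      then have "subst \<sigma> (g S') = 0"
        using proper_subst_one[OF g[of S'], of S] S' by (simp add: \<sigma>_def)
      then show ?thesis using iT by (simp add: fa.eval_mult ideal_zero)
    qed
    have "prod_list (map \<sigma> l) = 1" if "set l \<subseteq> S" for l
      using that by (induction l) (simp_all add: \<sigma>_def)
    moreover have "finite S" using less.prems W by (rule finite_subset)
    ultimately have "subst \<sigma> (sorted_monomial S) = 1"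
      by (simp add: fa.eval_prod_list o_def fa.eval_var)
    moreover have "subst \<sigma> (g S) = g S"
      using proper_subst_one[OF g[of S], of S] less.prems by (simp add: \<sigma>_def Diff_disjoint Int_commute)
    ultimately have one: "subst \<sigma> (sorted_monomial S * g S) = g S" by (simp add: fa.eval_mult)
    have "subst \<sigma> f = (\<Sum>S'\<in>Pow W. subst \<sigma> (sorted_monomial S' * g S'))"
      by (simp only: fg fa.eval_sum)
    also have "\<dots> = subst \<sigma> (sorted_monomial S * g S) + (\<Sum>S'\<in>Pow W - {S}. subst \<sigma> (sorted_monomial S' * g S'))"
      by (rule sum.remove) (use less.prems W in simp_all)
    finally have "subst \<sigma> f = g S + (\<Sum>S'\<in>Pow W - {S}. subst \<sigma> (sorted_monomial S' * g S'))"
      by (simp only: one)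
    moreover from ideal_diff[OF iT T_ideal_subst[OF T f(1), of \<sigma>] ideal_sum[OF iT summand]]
    have "subst \<sigma> f - (\<Sum>S'\<in>Pow W - {S}. subst \<sigma> (sorted_monomial S' * g S')) \<in> T" .
    ultimately show "g S \<in> T" by (simp only: add_diff_cancel_right')
  qed
  have "g S \<in> J" if "S \<in> Pow W" for S
    by (rule proper[of "W - S"]) (use that W g[of S] gT[of S] in simp_all)
  then show ?thesis
    unfolding fg by (intro ideal_sum[OF iJ] ideal_mult_left[OF iJ])
qed

section \<open>Normal forms\<close>

text \<open>
  Insertion sort for a relation invariant under adjacent transpositions, where the first \<open>k\<close> entries
  are protected. It is used for the letters of a product of commutators of length 2 (with \<open>k = 0\<close>) and
  for the tail of a long commutator (with \<open>k = 2\<close>).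
\<close>

lemma sort_by_adjacent_swaps:
  fixes R :: "'a::linorder list \<Rightarrow> 'a list \<Rightarrow> bool"
  assumes refl: "\<And>a. R a a" and trans: "\<And>a b c. R a b \<Longrightarrow> R b c \<Longrightarrow> R a c"
    and swap: "\<And>p x y q. k \<le> length p \<Longrightarrow> R (p @ x # y # q) (p @ y # x # q)"
    and "k \<le> length p"
  shows "R (p @ l) (p @ sort l)"
proof -
  have ins: "R (p @ x # l) (p @ insort x l)" if "k \<le> length p" for p x l
    using that
  proof (induction l arbitrary: p)
    case (Cons y l)
    show ?case
    proof (cases "x \<le> y")
      case False
      have "R (p @ x # y # l) (p @ y # x # l)" using Cons.prems by (rule swap)
      moreover have "R (p @ y # x # l) (p @ y # insort x l)"
        using Cons.IH[of "p @ [y]"] Cons.prems by simp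
      ultimately show ?thesis using False trans by simp
    qed (simp add: refl)
  qed (simp add: refl)
  show ?thesis using \<open>k \<le> length p\<close>
  proof (induction l arbitrary: p)
    case (Cons x l)
    have "R (p @ x # l) (p @ x # sort l)" using Cons.IH[of "p @ [x]"] Cons.prems by simp
    moreover have "R (p @ x # sort l) (p @ sort (x # l))" using ins[OF Cons.prems] by simp
    ultimately show ?case by (rule trans)
  qed (simp add: refl)
qed

text \<open>
  \<open>[x\<^sub>a, x\<^sub>b] [x\<^sub>c, x\<^sub>d] \<cdots>\<close> for a list \<open>a, b, c, d, \<dots>\<close> of even length; a single last letter is dropped.
\<close>

fun pair_product :: "nat list \<Rightarrow> 'k::field free_algebra" where
  "pair_product (x # y # l) = commutator (var x) (var y) * pair_product l"
| "pair_product _ = 1"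

lemma pair_product_append:
  "even (length l) \<Longrightarrow> pair_product (l @ l') = pair_product l * pair_product l'"
  by (induction l rule: pair_product.induct) (simp_all add: mult.assoc)

lemma pair_product_conv_commutators:
  obtains ps where "length ps = length l div 2"
    "pair_product l = (prod_list (map (\<lambda>(i, j). commutator (var i) (var j)) ps) :: 'k::field free_algebra)"
proof -
  have "\<exists>ps. length ps = length l div 2 \<and>
    (pair_product l :: 'k free_algebra) = prod_list (map (\<lambda>(i, j). commutator (var i) (var j)) ps)"
  proof (induction l rule: pair_product.induct)
    case (1 x y l)
    then obtain ps where "length ps = length l div 2"
      "(pair_product l :: 'k free_algebra) = prod_list (map (\<lambda>(i, j). commutator (var i) (var j)) ps)" by auto
    then show ?case by (intro exI[of _ "(x, y) # ps"]) simp
  qed auto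
  then show ?thesis using that by blast
qed

text \<open>
  The long factor of the normal form with index \<open>(C, R, i, D)\<close> has the letters \<open>R\<close> and begins with \<open>i\<close>,
  followed by the remaining letters in increasing order. As \<open>i\<close> is not the least one, its second
  letter is \<open>Min R\<close>.
\<close>

definition normal_form_indices :: "nat \<Rightarrow> nat set \<Rightarrow> (nat set \<times> nat set \<times> nat \<times> nat set) set" where
  "normal_form_indices m V = {(C, R, i, D). C \<union> R \<union> D = V \<and> C \<inter> R = {} \<and> C \<inter> D = {} \<and> R \<inter> D = {} \<and>
     even (card C) \<and> even (card D) \<and> card C + card D \<le> 2 * m \<and> 3 \<le> card R \<and> i \<in> R \<and> i \<noteq> Min R}"

definition normal_form :: "nat set \<times> nat set \<times> nat \<times> nat set \<Rightarrow> 'k::field free_algebra" where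
  "normal_form = (\<lambda>(C, R, i, D). pair_product (sorted_list_of_set C) *
     left_normed (i # sorted_list_of_set (R - {i})) * pair_product (sorted_list_of_set D))"

definition pair_products :: "nat set \<Rightarrow> 'k::field free_algebra set" where
  "pair_products V = {pair_product c | c. even (length c) \<and> distinct c \<and> set c = V}"

locale long_and_short_relations =
  fixes T :: "'k::field free_algebra set" and m :: nat
  assumes T: "T_ideal T"
    and gen_long: "commutator (commutator (var 1) (var 2)) (var 3) * commutator (commutator (var 4) (var 5)) (var 6) \<in> T"
    and gen_short: "prod_list (map (\<lambda>i. commutator (var (2 * i + 1)) (var (2 * i + 2))) [0..<m + 2]) \<in> T"
begin

lemma ideal: "two_sided_ideal T"
  using T by (simp add: T_ideal_def)

lemma long_long_adjacent: "commutator (commutator a b) c * commutator (commutator d e) f \<in> T"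
proof -
  define \<sigma> where "\<sigma> = (!) [0, a, b, c, d, e, f]"
  show ?thesis
    using T_ideal_subst[OF T gen_long, of \<sigma>]
    by (simp add: fa.eval_mult fa.eval_commutator fa.eval_var \<sigma>_def numeral_eq_Suc)
qed

text \<open>
  A factor between the two long commutators can be moved to the front, because \<open>[[[a, b], c], z]\<close>
  is again a long commutator.
\<close>

lemma long_long: "commutator (commutator a b) c * z * commutator (commutator d e) f \<in> T"
proof -
  let ?l = "commutator (commutator a b) c" and ?r = "commutator (commutator d e) f"
  have "?l * z * ?r = z * (?l * ?r) + commutator ?l z * ?r"
    by (simp add: commutator_def[of ?l z] algebra_simps)
  moreover have "commutator ?l z * ?r \<in> T" by (rule long_long_adjacent)
  ultimately show ?thesis
    using long_long_adjacent ideal by (simp add: ideal_add ideal_mult_left)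
qed

lemma many_commutators:
  assumes "m + 2 \<le> length ps"
  shows "prod_list (map (\<lambda>(a, b). commutator a b) ps) \<in> T"
proof -
  define \<sigma> where "\<sigma> i = (if odd i then fst (ps ! (i div 2)) else snd (ps ! (i div 2 - 1)))" for i
  have "subst \<sigma> (prod_list (map (\<lambda>i. commutator (var (2 * i + 1)) (var (2 * i + 2))) [0..<m + 2]))
    = prod_list (map (\<lambda>i. commutator (fst (ps ! i)) (snd (ps ! i))) [0..<m + 2])"
    by (simp add: fa.eval_prod_list fa.eval_mult fa.eval_commutator fa.eval_var o_def \<sigma>_def)
  also have "map (\<lambda>i. commutator (fst (ps ! i)) (snd (ps ! i))) [0..<m + 2] = map (\<lambda>(a, b). commutator a b) (take (m + 2) ps)"
    using assms by (intro nth_equalityI) (auto simp: case_prod_beta simp del: upt_Suc)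
  finally have "prod_list (map (\<lambda>(a, b). commutator a b) (take (m + 2) ps)) \<in> T"
    using T_ideal_subst[OF T gen_short, of \<sigma>] by simp
  then have "prod_list (map (\<lambda>(a, b). commutator a b) (take (m + 2) ps)) *
      prod_list (map (\<lambda>(a, b). commutator a b) (drop (m + 2) ps)) \<in> T"
    by (rule ideal_mult_right[OF ideal])
  then show ?thesis
    by (metis append_take_drop_id map_append prod_list.append)
qed

text \<open>
  Anything that holds for the other factors modulo this ideal holds modulo \<open>T\<close> in the presence of a long
  factor.
\<close>

definition long_annihilator :: "'k free_algebra set" where
  "long_annihilator = {h. \<forall>z u v w. h * z * commutator (commutator u v) w \<in> T \<and>
     commutator (commutator u v) w * z * h \<in> T}"

lemma ideal_long_annihilator: "two_sided_ideal long_annihilator"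
proof -
  have "f * g * z * commutator (commutator u v) w \<in> T" "g * f * z * commutator (commutator u v) w \<in> T"
    "commutator (commutator u v) w * z * (f * g) \<in> T" "commutator (commutator u v) w * z * (g * f) \<in> T"
    if f: "f \<in> long_annihilator" for f g z u v w
  proof -
    have f: "f * z * commutator (commutator u v) w \<in> T" "commutator (commutator u v) w * z * f \<in> T" for z
      using f by (auto simp: long_annihilator_def)
    show "f * g * z * commutator (commutator u v) w \<in> T" "commutator (commutator u v) w * z * (g * f) \<in> T"
      using f(1)[of "g * z"] f(2)[of "z * g"] by (simp_all add: mult.assoc)
    show "g * f * z * commutator (commutator u v) w \<in> T" "commutator (commutator u v) w * z * (f * g) \<in> T"
      using ideal_mult_left[OF ideal f(1)[of z], of g] ideal_mult_right[OF ideal f(2)[of z], of g]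
      by (simp_all add: mult.assoc)
  qed
  note absorb = this
  show ?thesis
    unfolding two_sided_ideal_def
  proof (intro conjI ballI allI)
    show "0 \<in> long_annihilator" by (simp add: long_annihilator_def ideal_zero[OF ideal])
    fix f assume f: "f \<in> long_annihilator"
    show "f + g \<in> long_annihilator" if "g \<in> long_annihilator" for g
      using f that by (auto simp: long_annihilator_def distrib_left distrib_right intro: ideal_add[OF ideal])
    show "g * f \<in> long_annihilator" "f * g \<in> long_annihilator" for g
      unfolding long_annihilator_def using absorb[OF f] by blast+
  qed
qed

lemma long_in_annihilator: "commutator (commutator a b) c \<in> long_annihilator"
  by (simp add: long_annihilator_def long_long)

text \<open>
  The derivation rule for \<open>[[a * d, b], c]\<close>, in which all terms but the two given ones have a long
  factor. This is the classical consequence \<open>[a, c] [d, b] + [a, b] [d, c]\<close> of \<open>[x, y, z]\<close> that makes products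
  of commutators of length 2 alternating.
\<close>

lemma exchange_in_annihilator:
  "commutator a c * commutator d b + commutator a b * commutator d c \<in> long_annihilator"
proof -
  have "commutator a c * commutator d b + commutator a b * commutator d c
    = commutator (commutator (a * d) b) c - a * commutator (commutator d b) c - commutator (commutator a b) c * d"
    by (simp add: commutator_def algebra_simps)
  also have "\<dots> \<in> long_annihilator"
    by (intro ideal_diff ideal_mult_left ideal_mult_right ideal_long_annihilator long_in_annihilator)
  finally show ?thesis .
qed

text \<open>
  For an even position this is \<open>[x, y] = - [y, x]\<close>; for an odd position the two letters belong to
  neighbouring commutators and are exchanged by \<open>exchange_in_annihilator\<close>.
\<close>

lemma pair_product_swap:
  assumes "even (length (p @ x # y # q))"
  shows "pair_product (p @ x # y # q) + pair_product (p @ y # x # q) \<in> long_annihilator"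
proof (cases "even (length p)")
  case True
  have "commutator (var x) (var y) + commutator (var y) (var x) = (0 :: 'k free_algebra)"
    by (simp add: commutator_def)
  then have "pair_product (p @ x # y # q) + pair_product (p @ y # x # q) = (0 :: 'k free_algebra)"
    using True by (simp add: pair_product_append flip: distrib_left distrib_right)
  then show ?thesis using ideal_zero[OF ideal_long_annihilator] by simp
next
  case False
  then obtain p' t where p: "p = p' @ [t]" by (cases p rule: rev_cases) auto
  obtain s q' where q: "q = s # q'" using assms False by (cases q) auto
  have "even (length p')" using False p by simp
  then have "pair_product (p @ x # y # q) + pair_product (p @ y # x # q)
    = - (pair_product p' * (commutator (var t) (var x) * commutator (var s) (var y)
        + commutator (var t) (var y) * commutator (var s) (var x)) * pair_product q')"
    by (simp add: p q pair_product_append) (simp add: commutator_def algebra_simps)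
  also have "\<dots> \<in> long_annihilator"
    by (intro ideal_uminus ideal_mult_left ideal_mult_right ideal_long_annihilator exchange_in_annihilator)
  finally show ?thesis .
qed

lemma pair_product_sort:
  assumes "even (length l)"
  shows "pair_product l - pair_product (sort l) \<in> long_annihilator \<or>
    pair_product l + pair_product (sort l) \<in> long_annihilator"
proof -
  note A = ideal_long_annihilator
  define R where "R a b \<longleftrightarrow> length a = length b \<and> (even (length a) \<longrightarrow>
    pair_product a - pair_product b \<in> long_annihilator \<or> pair_product a + pair_product b \<in> long_annihilator)" for a b
  have "R ([] @ l) ([] @ sort l)"
  proof (rule sort_by_adjacent_swaps[where k = 0])
    show "R a a" for a by (simp add: R_def ideal_zero[OF A])
    show "R a c" if "R a b" "R b c" for a b c
    proof -
      have "f - h \<in> long_annihilator \<or> f + h \<in> long_annihilator"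
        if "f - g \<in> long_annihilator \<or> f + g \<in> long_annihilator"
          "g - h \<in> long_annihilator \<or> g + h \<in> long_annihilator" for f g h
      proof -
        have "(f - g \<in> long_annihilator \<and> g - h \<in> long_annihilator) \<or> (f - g \<in> long_annihilator \<and> g + h \<in> long_annihilator)
          \<or> (f + g \<in> long_annihilator \<and> g - h \<in> long_annihilator) \<or> (f + g \<in> long_annihilator \<and> g + h \<in> long_annihilator)"
          using that by blast
        then show ?thesis
        proof (elim disjE conjE)
          assume "f - g \<in> long_annihilator" "g - h \<in> long_annihilator"
          from ideal_add[OF A this] show ?thesis by simp
        next
          assume "f - g \<in> long_annihilator" "g + h \<in> long_annihilator"
          from ideal_add[OF A this] show ?thesis by simp
        next
          assume "f + g \<in> long_annihilator" "g - h \<in> long_annihilator"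
          from ideal_diff[OF A this] show ?thesis by simp
        next
          assume "f + g \<in> long_annihilator" "g + h \<in> long_annihilator"
          from ideal_diff[OF A this] show ?thesis by simp
        qed
      qed
      then show ?thesis using that unfolding R_def by metis
    qed
    show "R (p @ x # y # q) (p @ y # x # q)" for p x y q
      using pair_product_swap[of p x y q] by (simp add: R_def)
  qed simp
  then show ?thesis using assms by (simp add: R_def)
qed

lemma ad_in_ideal: "f \<in> T \<Longrightarrow> ad f l \<in> T"
  by (induction l arbitrary: f) (simp_all add: ideal_commutator[OF ideal])

text \<open>
  Bracketing is a derivation, so repeated bracketing of \<open>u * v\<close> expands into the sum over all ways to
  distribute the letters over \<open>u\<close> and \<open>v\<close>. If both factors receive a letter, both become
  long and the term lies in \<open>T\<close>.
\<close>

lemma ad_commutator_product: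
  assumes "q \<noteq> []"
  shows "ad (commutator a b * commutator c d) q
    - (ad (commutator a b) q * commutator c d + commutator a b * ad (commutator c d) q) \<in> T"
proof -
  have left: "ad (commutator (commutator a b) e * commutator c d) l
      - ad (commutator (commutator a b) e) l * commutator c d \<in> T" for a b c d e l
  proof (induction l arbitrary: a b e)
    case (Cons x l)
    let ?u = "commutator (commutator a b) e" and ?v = "commutator c d"
    have "commutator (?u * ?v) (var x) = commutator ?u (var x) * ?v + ?u * commutator ?v (var x)"
      by (simp add: commutator_def[of _ "var x"] algebra_simps)
    then have "ad (?u * ?v) (x # l) - ad ?u (x # l) * ?v
      = (ad (commutator ?u (var x) * ?v) l - ad (commutator ?u (var x)) l * ?v) + ad (?u * commutator ?v (var x)) l"
      by (simp add: ad_add)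
    also have "\<dots> \<in> T"
      by (intro ideal_add[OF ideal] Cons.IH ad_in_ideal long_long_adjacent)
    finally show ?case .
  qed (simp add: ideal_zero[OF ideal])
  have right: "ad (commutator a b * commutator (commutator c d) e) l
      - commutator a b * ad (commutator (commutator c d) e) l \<in> T" for a b c d e l
  proof (induction l arbitrary: c d e)
    case (Cons x l)
    let ?u = "commutator a b" and ?v = "commutator (commutator c d) e"
    have "commutator (?u * ?v) (var x) = commutator ?u (var x) * ?v + ?u * commutator ?v (var x)"
      by (simp add: commutator_def[of _ "var x"] algebra_simps)
    then have "ad (?u * ?v) (x # l) - ?u * ad ?v (x # l)
      = ad (commutator ?u (var x) * ?v) l + (ad (?u * commutator ?v (var x)) l - ?u * ad (commutator ?v (var x)) l)"
      by (simp add: ad_add)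
    also have "\<dots> \<in> T"
      by (intro ideal_add[OF ideal] Cons.IH ad_in_ideal long_long_adjacent)
    finally show ?case .
  qed (simp add: ideal_zero[OF ideal])
  obtain x l where q: "q = x # l" using assms by (cases q) auto
  let ?u = "commutator a b" and ?v = "commutator c d"
  have "commutator (?u * ?v) (var x) = commutator ?u (var x) * ?v + ?u * commutator ?v (var x)"
    by (simp add: commutator_def[of _ "var x"] algebra_simps)
  then have "ad (?u * ?v) q - (ad ?u q * ?v + ?u * ad ?v q)
    = (ad (commutator ?u (var x) * ?v) l - ad (commutator ?u (var x)) l * ?v)
      + (ad (?u * commutator ?v (var x)) l - ?u * ad (commutator ?v (var x)) l)"
    by (simp add: q ad_add)
  also have "\<dots> \<in> T" by (intro ideal_add[OF ideal] left right)
  finally show ?thesis .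
qed

text \<open>
  The span of the normal forms of content \<open>V\<close> modulo \<open>T\<close>, together with all products of commutators of
  length 2. No normal form is chosen for the latter, because those combinations of them that are identities
  belong to the generators of the T-ideal.
\<close>

definition normal_span :: "nat set \<Rightarrow> 'k free_algebra set" where
  "normal_span V = fa.span (pair_products V \<union> normal_form ` normal_form_indices m V \<union> T)"

lemma normal_span_add: "f \<in> normal_span V \<Longrightarrow> g \<in> normal_span V \<Longrightarrow> f + g \<in> normal_span V"
  and normal_span_diff: "f \<in> normal_span V \<Longrightarrow> g \<in> normal_span V \<Longrightarrow> f - g \<in> normal_span V"
  and normal_span_uminus: "f \<in> normal_span V \<Longrightarrow> - f \<in> normal_span V"
  and normal_span_zero: "0 \<in> normal_span V"
  and normal_span_T: "f \<in> T \<Longrightarrow> f \<in> normal_span V"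
  by (auto simp: normal_span_def fa.span_add fa.span_diff fa.span_neg fa.span_zero fa.span_base)

lemma normal_span_pair_product:
  "even (length c) \<Longrightarrow> distinct c \<Longrightarrow> set c = V \<Longrightarrow> pair_product c \<in> normal_span V"
  by (auto simp: normal_span_def pair_products_def intro: fa.span_base)

lemma normal_span_sandwich_sorted:
  assumes long: "3 \<le> length l" and cd: "even (length c)" "even (length d)"
    and sorted: "pair_product (sort c) * left_normed l * pair_product (sort d) \<in> normal_span V"
  shows "pair_product c * left_normed l * pair_product d \<in> normal_span V"
proof -
  note I = ideal
  obtain u v w where l: "left_normed l = (commutator (commutator u v) w :: 'k free_algebra)"
    by (rule left_normed_is_long_commutator[OF long])
  let ?c = "pair_product c :: 'k free_algebra" and ?c' = "pair_product (sort c) :: 'k free_algebra"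
    and ?d = "pair_product d :: 'k free_algebra" and ?d' = "pair_product (sort d) :: 'k free_algebra"
    and ?l = "left_normed l :: 'k free_algebra"
  have h1: "h * ?l \<in> T" and h2: "?l * h \<in> T" if "h \<in> long_annihilator" for h
    using that[unfolded long_annihilator_def mem_Collect_eq, rule_format, of 1 u v w] by (simp_all add: l)
  from pair_product_sort[OF cd(1)] have "?c * ?l - ?c' * ?l \<in> T \<or> ?c * ?l + ?c' * ?l \<in> T"
    using h1 by (metis left_diff_distrib distrib_right)
  then have c: "?c * ?l * ?d' - ?c' * ?l * ?d' \<in> T \<or> ?c * ?l * ?d' + ?c' * ?l * ?d' \<in> T"
    using ideal_mult_right[OF I] by (metis left_diff_distrib distrib_right)
  have "?c * ?l * ?d' \<in> normal_span V"
  proof (rule disjE[OF c])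
    assume "?c * ?l * ?d' - ?c' * ?l * ?d' \<in> T"
    from normal_span_add[OF normal_span_T[OF this] sorted] show ?thesis by simp
  next
    assume "?c * ?l * ?d' + ?c' * ?l * ?d' \<in> T"
    from normal_span_diff[OF normal_span_T[OF this] sorted] show ?thesis by simp
  qed
  note sorted' = this
  from pair_product_sort[OF cd(2)] have "?l * ?d - ?l * ?d' \<in> T \<or> ?l * ?d + ?l * ?d' \<in> T"
    using h2 by (metis right_diff_distrib distrib_left)
  then have d: "?c * ?l * ?d - ?c * ?l * ?d' \<in> T \<or> ?c * ?l * ?d + ?c * ?l * ?d' \<in> T"
    using ideal_mult_left[OF I] by (metis right_diff_distrib distrib_left mult.assoc)
  show ?thesis
  proof (rule disjE[OF d])
    assume "?c * ?l * ?d - ?c * ?l * ?d' \<in> T"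
    from normal_span_add[OF normal_span_T[OF this] sorted'] show ?thesis by simp
  next
    assume "?c * ?l * ?d + ?c * ?l * ?d' \<in> T"
    from normal_span_diff[OF normal_span_T[OF this] sorted'] show ?thesis by simp
  qed
qed

lemma too_many_factors:
  assumes "2 \<le> length l" "even (length c)" "even (length d)" "2 * m < length c + length d"
  shows "pair_product c * left_normed l * pair_product d \<in> T"
proof -
  obtain cs where cs: "length cs = length c div 2"
    "(pair_product c :: 'k free_algebra) = prod_list (map (\<lambda>(i, j). commutator (var i) (var j)) cs)"
    by (rule pair_product_conv_commutators)
  obtain ds where ds: "length ds = length d div 2"
    "(pair_product d :: 'k free_algebra) = prod_list (map (\<lambda>(i, j). commutator (var i) (var j)) ds)"
    by (rule pair_product_conv_commutators)
  obtain u v where l: "left_normed l = (commutator u v :: 'k free_algebra)"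
    by (rule left_normed_is_commutator[OF assms(1)])
  let ?vars = "map (map_prod var var) :: (nat \<times> nat) list \<Rightarrow> ('k free_algebra \<times> 'k free_algebra) list"
  have "m + 2 \<le> length (?vars cs @ (u, v) # ?vars ds)" using assms cs(1) ds(1) by (auto elim!: evenE)
  from many_commutators[OF this] show ?thesis
    by (simp add: cs ds l mult.assoc o_def map_prod_def split_def)
qed

text \<open>
  Induction on the length of the long factor. Exchanging two adjacent letters \<open>x\<close>, \<open>y\<close> behind the first
  two changes \<open>[u, x, y, \<dots>]\<close> by \<open>[u, [x, y], \<dots>]\<close>, that is, up to \<open>T\<close>, by products in which the
  long factor has been replaced by two commutators. At most one of these is still long, and it is shorter; a
  commutator of length 2 is absorbed by the neighbouring product. So the tail may be sorted.
  The Jacobi identity \<open>[a, b, \<mu>] = [a, \<mu>, b] - [b, \<mu>, a]\<close> then brings the least letter \<open>\<mu>\<close> to the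
  second position.
\<close>

lemma sandwich_in_normal_span:
  assumes "3 \<le> length l" "even (length c)" "even (length d)" "distinct (c @ l @ d)"
  shows "pair_product c * left_normed l * pair_product d \<in> normal_span (set (c @ l @ d))"
  using assms
proof (induction "length l" arbitrary: c l d rule: less_induct)
  case less
  note I = ideal
  define V where "V = set (c @ l @ d)"
  define sandwich where "sandwich f = pair_product c * f * pair_product d" for f :: "'k free_algebra"
  have sw_diff: "sandwich (f - g) = sandwich f - sandwich g"
    and sw_add: "sandwich (f + g) = sandwich f + sandwich g"
    and sw_uminus: "sandwich (- f) = - sandwich f" for f g
    by (simp_all add: sandwich_def algebra_simps)
  have sw_T: "sandwich f \<in> T" if "f \<in> T" for f
    unfolding sandwich_def by (intro ideal_mult_left ideal_mult_right I that)
  have content: "distinct (c @ a @ d) \<and> set (c @ a @ d) = V" if "mset a = mset l" for a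
    using that less.prems(4) mset_eq_setD[OF that] mset_eq_imp_distinct_iff[OF that] by (auto simp: V_def)
  (* Two commutators in place of the long one: both long, one long, or none long. *)
  have two: "sandwich (left_normed a * left_normed b) \<in> normal_span V"
    if ab: "2 \<le> length a" "2 \<le> length b" "mset (a @ b) = mset l" for a b
  proof -
    have len: "length a + length b = length l"
      using mset_eq_length[OF ab(3)] by simp
    have dist: "distinct (c @ (a @ b) @ d)" and V: "set (c @ (a @ b) @ d) = V"
      using content[OF ab(3)] by auto
    have pair: "\<exists>x y. l = [x, y]" if "2 \<le> length l" "\<not> 3 \<le> length l" for l :: "nat list"
      using that by (cases l; cases "tl l"; cases "tl (tl l)") auto
    have pair_ln: "left_normed [x, y] = (pair_product [x, y] :: 'k free_algebra)" for x y
      by (simp add: left_normed_def)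
    show ?thesis
    proof (cases "3 \<le> length a")
      case a: True
      obtain u v w where la: "left_normed a = (commutator (commutator u v) w :: 'k free_algebra)"
        by (rule left_normed_is_long_commutator[OF a])
      show ?thesis
      proof (cases "3 \<le> length b")
        case True
        obtain u' v' w' where lb: "left_normed b = (commutator (commutator u' v') w' :: 'k free_algebra)"
          by (rule left_normed_is_long_commutator[OF True])
        show ?thesis
          unfolding la lb by (intro normal_span_T sw_T long_long_adjacent)
      next
        case False
        then obtain x y where b: "b = [x, y]" using pair ab by blast
        have "pair_product c * left_normed a * pair_product (b @ d) \<in> normal_span (set (c @ a @ b @ d))"
          by (rule less.hyps) (use a b len less.prems dist in auto)
        then show ?thesis
          using V by (simp add: sandwich_def b pair_ln mult.assoc)
      qed
    next
      case False
      then obtain x y where a: "a = [x, y]" using pair ab by blast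
      show ?thesis
      proof (cases "3 \<le> length b")
        case True
        have "pair_product (c @ a) * left_normed b * pair_product d \<in> normal_span (set ((c @ a) @ b @ d))"
          by (rule less.hyps) (use True a len less.prems dist in auto)
        then show ?thesis
          using V less.prems by (simp add: sandwich_def a pair_ln pair_product_append mult.assoc)
      next
        case False
        then obtain z w where b: "b = [z, w]" using pair ab by blast
        have "pair_product (c @ a @ b @ d) \<in> normal_span V"
          by (rule normal_span_pair_product) (use dist V less.prems a b in auto)
        then show ?thesis
          using less.prems by (simp add: sandwich_def a b pair_ln pair_product_append mult.assoc)
      qed
    qed
  qed
  define R where "R a b \<longleftrightarrow> mset a = mset b \<and>
    (mset a = mset l \<longrightarrow> sandwich (left_normed a) - sandwich (left_normed b) \<in> normal_span V)" for a b
  have tail_sort: "R (p @ t) (p @ sort t)" if "2 \<le> length p" for p t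
  proof (rule sort_by_adjacent_swaps[where k = 2, OF _ _ _ that])
    show "R a a" for a by (simp add: R_def normal_span_zero)
    show "R a c" if "R a b" "R b c" for a b c
      using that normal_span_add[of "sandwich (left_normed a) - sandwich (left_normed b)" V
        "sandwich (left_normed b) - sandwich (left_normed c)"] by (auto simp: R_def)
    show "R (p @ x # y # q) (p @ y # x # q)" if p: "2 \<le> length p" for p x y q
    proof -
      have "sandwich (left_normed (p @ x # y # q)) - sandwich (left_normed (p @ y # x # q)) \<in> normal_span V"
        if ms: "mset (p @ x # y # q) = mset l"
      proof -
        have p0: "p \<noteq> []" using p by auto
        obtain a b where lp: "left_normed p = (commutator a b :: 'k free_algebra)"
          by (rule left_normed_is_commutator[OF p])
        let ?u = "left_normed p :: 'k free_algebra" and ?v = "left_normed [x, y] :: 'k free_algebra"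
        have lv: "?v = commutator (var x) (var y)" by (simp add: left_normed_def)
        have "left_normed (p @ x # y # q) - left_normed (p @ y # x # q)
          = ad (commutator (commutator ?u (var x)) (var y) - commutator (commutator ?u (var y)) (var x)) q"
          using p0 by (simp add: left_normed_append ad_diff)
        also have "commutator (commutator ?u (var x)) (var y) - commutator (commutator ?u (var y)) (var x) = ?u * ?v - ?v * ?u"
          by (simp add: lv commutator_def algebra_simps)
        finally have diff: "left_normed (p @ x # y # q) - left_normed (p @ y # x # q) = ad (?u * ?v) q - ad (?v * ?u) q"
          by (simp add: ad_diff)
        have "sandwich (ad (?u * ?v) q) \<in> normal_span V \<and> sandwich (ad (?v * ?u) q) \<in> normal_span V"
        proof (cases "q = []")
          case True
          then show ?thesis using two[of p "[x, y]"] two[of "[x, y]" p] p ms by (simp add: ac_simps)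
        next
          case False
          have uq: "ad ?u q = left_normed (p @ q)" using p0 by (simp add: left_normed_append)
          have vq: "ad ?v q = left_normed (x # y # q)" by (simp add: left_normed_def)
          have 1: "sandwich (ad (?u * ?v) q - (left_normed (p @ q) * ?v + ?u * left_normed (x # y # q))) \<in> normal_span V"
            using ad_commutator_product[OF False, of a b "var x" "var y", folded lp lv]
            unfolding uq vq by (intro normal_span_T sw_T)
          have 2: "sandwich (ad (?v * ?u) q - (left_normed (x # y # q) * ?u + ?v * left_normed (p @ q))) \<in> normal_span V"
            using ad_commutator_product[OF False, of "var x" "var y" a b, folded lp lv]
            unfolding uq vq by (intro normal_span_T sw_T)
          have 3: "sandwich (left_normed (p @ q) * ?v + ?u * left_normed (x # y # q)) \<in> normal_span V"
            unfolding sw_add by (intro normal_span_add two) (use p ms in \<open>auto simp: ac_simps\<close>)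
          have 4: "sandwich (left_normed (x # y # q) * ?u + ?v * left_normed (p @ q)) \<in> normal_span V"
            unfolding sw_add by (intro normal_span_add two) (use p ms in \<open>auto simp: ac_simps\<close>)
          show ?thesis
            using normal_span_add[OF 1 3] normal_span_add[OF 2 4] by (simp flip: sw_add)
        qed
        then show ?thesis
          by (simp add: diff normal_span_diff flip: sw_diff) (simp add: sw_diff normal_span_diff)
      qed
      then show ?thesis by (simp add: R_def)
    qed
  qed
  have sorted_tail: "sandwich (left_normed (p @ t)) \<in> normal_span V"
    if "2 \<le> length p" "mset (p @ t) = mset l" "sandwich (left_normed (p @ sort t)) \<in> normal_span V" for p t
    using tail_sort[OF that(1), of t] that(2) normal_span_add[OF _ that(3)] by (fastforce simp: R_def)
  define mn where "mn = Min (set l)"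
  have mn: "mn \<in> set l" unfolding mn_def by (rule Min_in) (use less.prems in auto)
  have dl: "distinct l" using less.prems by simp
  have second_min: "sandwich (left_normed (i # mn # t)) \<in> normal_span V" if ms: "mset (i # mn # t) = mset l" for i t
  proof -
    have d: "distinct (i # mn # t)" using dl mset_eq_imp_distinct_iff[OF ms] by simp
    have s: "set l = set (i # mn # t)" using mset_eq_setD[OF ms] ..
    have "mn \<le> x" if "x \<in> set t" for x
      unfolding mn_def by (rule Min_le) (simp_all add: s that)
    then have "sorted (mn # sort t)" by simp
    moreover have "set l - {i} = set (mn # sort t)" using d s by auto
    ultimately have eq: "sorted_list_of_set (set l - {i}) = mn # sort t"
      using d by (metis distinct.simps(2) distinct_sort set_sort sorted_list_of_set.idem_if_sorted_distinct)
    have "sandwich (left_normed (i # mn # sort t)) \<in> normal_span V"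
    proof (cases "2 * m < length c + length d")
      case True
      have "2 \<le> length (i # mn # sort t)" by simp
      then show ?thesis unfolding sandwich_def
        by (intro normal_span_T too_many_factors less.prems True)
    next
      case False
      have dist: "distinct c" "distinct d" using less.prems by auto
      have "i \<in> set l" unfolding s by simp
      moreover have "i \<noteq> Min (set l)" using d by (simp flip: mn_def)
      moreover have "card (set c) = length c" "card (set l) = length l" "card (set d) = length d"
        using dist dl by (simp_all add: distinct_card)
      moreover have "set c \<union> set l \<union> set d = V" "set c \<inter> set l = {}" "set c \<inter> set d = {}" "set l \<inter> set d = {}"
        using less.prems by (auto simp: V_def)
      ultimately have "(set c, set l, i, set d) \<in> normal_form_indices m V"
        unfolding normal_form_indices_def using False less.prems by simp
      then have nf: "normal_form (set c, set l, i, set d) \<in> normal_span V"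
        unfolding normal_span_def by (intro fa.span_base) auto
      have "3 \<le> length (i # mn # sort t)" using less.prems(1) mset_eq_length[OF ms] by simp
      then show ?thesis unfolding sandwich_def
        by (rule normal_span_sandwich_sorted)
          (use nf less.prems dist in \<open>simp_all add: normal_form_def eq sorted_list_of_set_sort_remdups distinct_remdups_id\<close>)
    qed
    then show ?thesis
      using sorted_tail[of "[i, mn]" t] ms by simp
  qed
  obtain a b t where l: "l = a # b # t" using less.prems(1) by (cases l; cases "tl l") auto
  have "sandwich (left_normed l) \<in> normal_span V"
  proof -
    consider "b = mn" | "a = mn" | "a \<noteq> mn" "b \<noteq> mn" by blast
    then show ?thesis
    proof cases
      case 1
      then show ?thesis using second_min[of a t] l by simp
    next
      case 2
      have "left_normed l = - (left_normed (b # mn # t) :: 'k free_algebra)"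
        by (simp add: l 2 left_normed_def flip: ad_uminus) (simp add: commutator_def)
      then show ?thesis
        using second_min[of b t] l 2 by (simp add: sw_uminus normal_span_uminus add_mset_commute)
    next
      case 3
      then have mt: "mn \<in> set t" using mn l by auto
      define rest where "rest = sort (remove1 mn t)"
      have ge: "mn \<le> x" if "x \<in> set t" for x
        unfolding mn_def by (rule Min_le) (simp_all add: l that)
      have "sort t = mn # rest"
      proof (rule properties_for_sort)
        show "mset (mn # rest) = mset t" using mt by (simp add: rest_def)
        show "sorted (mn # rest)"
          using ge set_remove1_subset[of mn t] by (auto simp: rest_def)
      qed
      moreover have "left_normed (a # b # mn # rest)
        = left_normed (a # mn # b # rest) - (left_normed (b # mn # a # rest) :: 'k free_algebra)"
        by (simp add: left_normed_def flip: ad_diff) (simp add: commutator_def algebra_simps)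
      moreover have "mset t = add_mset mn (mset rest)" using mt by (simp add: rest_def)
      then have "sandwich (left_normed (a # mn # b # rest)) \<in> normal_span V"
        "sandwich (left_normed (b # mn # a # rest)) \<in> normal_span V"
        by (intro second_min; simp add: l)+
      ultimately show ?thesis
        using sorted_tail[of "[a, b]" t] l by (simp add: sw_diff normal_span_diff)
    qed
  qed
  then show ?case by (simp add: sandwich_def V_def)
qed

lemma left_normed_product_pairs:
  assumes "\<forall>l\<in>set ls. length l = 2"
  shows "left_normed_product ls = pair_product (concat ls)" "even (length (concat ls))"
proof -
  have "left_normed_product ls = pair_product (concat ls) \<and> even (length (concat ls))"
    using assms
  proof (induction ls)
    case (Cons l ls)
    then obtain x y where "l = [x, y]" by (auto simp: numeral_2_eq_2 length_Suc_conv)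
    then show ?case using Cons by (simp add: left_normed_def)
  qed simp
  then show "left_normed_product ls = pair_product (concat ls)" "even (length (concat ls))" by auto
qed

text \<open>
  Two long factors give an element of \<open>T\<close>. With one long factor the product has the shape treated
  in \<open>sandwich_in_normal_span\<close>, and without long factors nothing has to be done.
\<close>

lemma proper_subset_normal_span: "proper V \<subseteq> normal_span V"
proof -
  have "left_normed_product ls \<in> normal_span V" if ls: "commutator_factors V ls" for ls
  proof (cases "\<forall>l\<in>set ls. length l = 2")
    case True
    show ?thesis
      unfolding left_normed_product_pairs(1)[OF True]
      using ls left_normed_product_pairs(2)[OF True]
      by (intro normal_span_pair_product) (auto simp: commutator_factors_def)
  next
    case False
    then obtain l where "l \<in> set ls" "length l \<noteq> 2" by blast
    then obtain ls1 ls2 where split: "ls = ls1 @ l # ls2" and long: "3 \<le> length l"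
      using ls by (force simp: commutator_factors_def dest: split_list)
    obtain u v w where l: "left_normed l = (commutator (commutator u v) w :: 'k free_algebra)"
      by (rule left_normed_is_long_commutator[OF long])
    have long_factor: "\<exists>u v w y z. left_normed_product ls' = y * commutator (commutator u v) w * (z :: 'k free_algebra)"
      if l: "l' \<in> set ls'" "length l' \<noteq> 2" and "set ls' \<subseteq> set ls" for l' ls'
    proof -
      have "3 \<le> length l'" using that ls by (force simp: commutator_factors_def)
      then obtain u v w where "left_normed l' = (commutator (commutator u v) w :: 'k free_algebra)"
        by (rule left_normed_is_long_commutator)
      moreover obtain a b where "ls' = a @ l' # b" using l(1) by (auto dest: split_list)
      ultimately have "left_normed_product ls' = left_normed_product a * commutator (commutator u v) w * (left_normed_product b :: 'k free_algebra)"
        by (simp add: mult.assoc)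
      then show ?thesis by blast
    qed
    have eq: "left_normed_product ls = left_normed_product ls1 * left_normed l * (left_normed_product ls2 :: 'k free_algebra)"
      by (simp add: split mult.assoc)
    show ?thesis
    proof (cases "(\<forall>l\<in>set ls1. length l = 2) \<and> (\<forall>l\<in>set ls2. length l = 2)")
      case True
      then have "left_normed_product ls = pair_product (concat ls1) * left_normed l * (pair_product (concat ls2) :: 'k free_algebra)"
        unfolding eq by (simp add: left_normed_product_pairs(1))
      moreover have "\<dots> \<in> normal_span (set (concat ls1 @ l @ concat ls2))"
        using True left_normed_product_pairs(2) long ls
        by (intro sandwich_in_normal_span) (auto simp: split commutator_factors_def)
      moreover have "set (concat ls1 @ l @ concat ls2) = V" using ls by (auto simp: split commutator_factors_def)
      ultimately show ?thesis by simp
    next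
      case False
      have sub: "set ls1 \<subseteq> set ls" "set ls2 \<subseteq> set ls" by (auto simp: split)
      from False consider l' where "l' \<in> set ls1" "length l' \<noteq> 2" | l' where "l' \<in> set ls2" "length l' \<noteq> 2" by blast
      then have "left_normed_product ls \<in> T"
      proof cases
        case 1
        then obtain u' v' w' y z where "left_normed_product ls1 = y * commutator (commutator u' v') w' * (z :: 'k free_algebra)"
          using long_factor[OF 1 sub(1)] by blast
        then have "left_normed_product ls = y * (commutator (commutator u' v') w' * z * commutator (commutator u v) w) * left_normed_product ls2"
          by (simp add: eq l mult.assoc)
        also have "\<dots> \<in> T" by (intro ideal_mult_left ideal_mult_right ideal long_long)
        finally show ?thesis .
      next
        case 2
        then obtain u' v' w' y z where "left_normed_product ls2 = y * commutator (commutator u' v') w' * (z :: 'k free_algebra)"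
          using long_factor[OF 2 sub(2)] by blast
        then have "left_normed_product ls = left_normed_product ls1 * (commutator (commutator u v) w * y * commutator (commutator u' v') w') * z"
          by (simp add: eq l mult.assoc)
        also have "\<dots> \<in> T" by (intro ideal_mult_left ideal_mult_right ideal long_long)
        finally show ?thesis .
      qed
      then show ?thesis by (rule normal_span_T)
    qed
  qed
  then show ?thesis
    unfolding proper_def normal_span_def by (intro fa.span_minimal fa.subspace_span) (auto simp: normal_span_def)
qed

end

section \<open>Commutators in Grassmann algebras\<close>

lemma inversions_add_swap:
  assumes "finite T" "finite U" "T \<inter> U = {}"
  shows "inversions T U + inversions U T = card T * card U"
proof -
  let ?A = "{(t, u). t \<in> T \<and> u \<in> U \<and> u < t}" and ?B = "{(t, u). t \<in> T \<and> u \<in> U \<and> t < u}"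
  have fin: "finite ?A" "finite ?B"
    by (rule finite_subset[of _ "T \<times> U"]; use assms in auto)+
  have "inversions U T = card (prod.swap ` {(u, t). u \<in> U \<and> t \<in> T \<and> t < u})"
    unfolding inversions_def by (rule card_image[symmetric]) simp
  also have "prod.swap ` {(u, t). u \<in> U \<and> t \<in> T \<and> t < u} = ?B"
    by (auto simp: image_iff)
  finally have "inversions T U + inversions U T = card ?A + card ?B"
    by (simp add: inversions_def)
  also have "\<dots> = card (?A \<union> ?B)"
    by (rule card_Un_disjoint[symmetric]) (use fin in auto)
  also have "?A \<union> ?B = T \<times> U"
  proof -
    have "u < t \<or> t < u" if "t \<in> T" "u \<in> U" for t u
      using that assms(3) by (metis disjoint_iff linorder_neqE_nat)
    then show ?thesis by blast
  qed
  finally show ?thesis by (simp add: card_cartesian_product)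
qed

lemma gcoeff_simps [simp]:
  "gcoeff 0 S = 0" "gcoeff (a + b) S = gcoeff a S + gcoeff b S" "gcoeff (- a) S = - gcoeff a S"
  "gcoeff (a - b) S = gcoeff a S - gcoeff b S" "gcoeff 1 S = (if S = {} then 1 else 0)"
proof -
  show "gcoeff 0 S = 0" by (simp add: zero_grassmann.rep_eq)
  show "gcoeff (a + b) S = gcoeff a S + gcoeff b S" by (simp add: plus_grassmann.rep_eq)
  show "gcoeff (- a) S = - gcoeff a S" by (simp add: uminus_grassmann.rep_eq)
  show "gcoeff (a - b) S = gcoeff a S - gcoeff b S"
    by (simp only: minus_grassmann_def plus_grassmann.rep_eq uminus_grassmann.rep_eq diff_conv_add_uminus)
  show "gcoeff 1 S = (if S = {} then 1 else 0)" by (simp add: one_grassmann.rep_eq)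
qed

lemma gcoeff_scale [simp]: "gcoeff (gr_scale c a) S = c * gcoeff a S"
  by (simp add: gr_scale.rep_eq)

lemma gcoeff_mult_nonzeroE:
  fixes a b :: "'k::field grassmann"
  assumes "gcoeff (a * b) S \<noteq> 0"
  obtains T where "T \<subseteq> S" "finite S" "gcoeff a T \<noteq> 0" "gcoeff b (S - T) \<noteq> 0"
proof -
  have "finite S" using assms gcoeff_infinite by blast
  moreover from assms obtain T where "T \<in> Pow S" "(- 1) ^ inversions T (S - T) * gcoeff a T * gcoeff b (S - T) \<noteq> 0"
    unfolding times_grassmann.rep_eq gconv_def by (auto elim: sum.not_neutral_contains_not_neutral)
  ultimately show ?thesis using that by auto
qed

text \<open>
  The monomials \<open>e\<^sub>T\<close> and \<open>e\<^sub>U\<close> commute up to the sign \<open>(- 1) ^ (card T * card U)\<close>, so only pairs of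
  monomials of odd degree contribute to a commutator.
\<close>

lemma gcoeff_commutator_nonzeroE:
  fixes a b :: "'k::field grassmann"
  assumes "gcoeff (commutator a b) S \<noteq> 0"
  obtains T where "T \<subseteq> S" "finite S" "odd (card T)" "odd (card (S - T))" "gcoeff a T \<noteq> 0"
proof -
  have fin: "finite S" using assms gcoeff_infinite by blast
  have "gcoeff (b * a) S = (\<Sum>T\<in>Pow S. (- 1) ^ inversions T (S - T) * gcoeff b T * gcoeff a (S - T))"
    by (simp add: times_grassmann.rep_eq gconv_def)
  also have "\<dots> = (\<Sum>T\<in>Pow S. (- 1) ^ inversions (S - T) T * gcoeff b (S - T) * gcoeff a T)"
    by (rule sum.reindex_bij_witness[where i = "\<lambda>T. S - T" and j = "\<lambda>T. S - T"])
      (auto simp: double_diff)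
  finally have "gcoeff (commutator a b) S = (\<Sum>T\<in>Pow S.
     ((- 1) ^ inversions T (S - T) - (- 1) ^ inversions (S - T) T) * (gcoeff a T * gcoeff b (S - T)))"
    by (simp add: commutator_def times_grassmann.rep_eq gconv_def sum_subtractf algebra_simps)
  with assms obtain T where T: "T \<in> Pow S"
    "((- 1) ^ inversions T (S - T) - (- 1) ^ inversions (S - T) T) * (gcoeff a T * gcoeff b (S - T)) \<noteq> 0"
    by (metis (no_types, lifting) sum.not_neutral_contains_not_neutral)
  have sum: "inversions T (S - T) + inversions (S - T) T = card T * card (S - T)"
    by (rule inversions_add_swap) (use T fin in \<open>auto intro: finite_subset\<close>)
  have "odd (card T * card (S - T))"
  proof (rule ccontr)
    assume "\<not> ?thesis"
    then have "even (inversions T (S - T)) = even (inversions (S - T) T)" using sum by (metis even_add)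
    then have "(- 1) ^ inversions T (S - T) = ((- 1) ^ inversions (S - T) T :: 'k)"
      by (simp add: minus_one_power_iff)
    then show False using T(2) by simp
  qed
  then show ?thesis using that T fin by auto
qed

definition degree_at_least :: "nat \<Rightarrow> 'k::field grassmann set" where
  "degree_at_least k = {a. \<forall>S. gcoeff a S \<noteq> 0 \<longrightarrow> k \<le> card S}"

lemma degree_at_least_add:
  "a \<in> degree_at_least k \<Longrightarrow> b \<in> degree_at_least k \<Longrightarrow> a + b \<in> degree_at_least k"
  unfolding degree_at_least_def by (auto, metis add.right_neutral)

lemma degree_at_least_mult:
  assumes "a \<in> degree_at_least k" "b \<in> degree_at_least l"
  shows "a * b \<in> degree_at_least (k + l)"
  unfolding degree_at_least_def mem_Collect_eq
proof (intro allI impI)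
  fix S assume "gcoeff (a * b) S \<noteq> 0"
  then obtain T where T: "T \<subseteq> S" "finite S" "gcoeff a T \<noteq> 0" "gcoeff b (S - T) \<noteq> 0"
    by (rule gcoeff_mult_nonzeroE)
  have "k \<le> card T" "l \<le> card (S - T)" using T assms by (auto simp: degree_at_least_def)
  moreover have "card S = card T + card (S - T)"
    using T by (metis add.commute card_Diff_subset card_mono finite_subset le_add_diff_inverse2)
  ultimately show "k + l \<le> card S" by simp
qed

lemma degree_at_least_mono: "k \<le> l \<Longrightarrow> a \<in> degree_at_least l \<Longrightarrow> a \<in> degree_at_least k"
  unfolding degree_at_least_def by fastforce

lemma commutator_degree: "commutator a b \<in> degree_at_least 2"
  unfolding degree_at_least_def mem_Collect_eq
proof (intro allI impI)
  fix S assume "gcoeff (commutator a b) S \<noteq> 0"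
  then obtain T where T: "T \<subseteq> S" "finite S" "odd (card T)" "odd (card (S - T))"
    by (rule gcoeff_commutator_nonzeroE)
  have "card S = card T + card (S - T)"
    using T by (metis add.commute card_Diff_subset card_mono finite_subset le_add_diff_inverse2)
  moreover have "card T \<noteq> 0" "card (S - T) \<noteq> 0" using T by (metis even_zero)+
  ultimately show "2 \<le> card S" by linarith
qed

text \<open>
  A commutator has only terms of even degree, and a term of a further commutator would need one of odd
  degree.
\<close>

lemma grassmann_long_commutator: "commutator (commutator a b) c = (0 :: 'k::field grassmann)"
proof (rule grassmann_eqI)
  fix S :: "nat set"
  show "gcoeff (commutator (commutator a b) c) S = gcoeff 0 S"
  proof (rule ccontr)
    assume "gcoeff (commutator (commutator a b) c) S \<noteq> gcoeff 0 S"
    then have "gcoeff (commutator (commutator a b) c) S \<noteq> 0" by simp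
    then obtain T where T: "odd (card T)" "gcoeff (commutator a b) T \<noteq> 0"
      by (rule gcoeff_commutator_nonzeroE)
    from T(2) obtain U where U: "U \<subseteq> T" "finite T" "odd (card U)" "odd (card (T - U))"
      by (rule gcoeff_commutator_nonzeroE)
    have "card T = card U + card (T - U)"
      using U by (metis add.commute card_Diff_subset card_mono finite_subset le_add_diff_inverse2)
    then show False using T(1) U by simp
  qed
qed

lemma Grassmann_degree_zero:
  assumes "a \<in> Grassmann k" "a \<in> degree_at_least l" "k < l"
  shows "a = 0"
proof (rule grassmann_eqI, rule ccontr)
  fix S :: "nat set" assume "gcoeff a S \<noteq> gcoeff 0 S"
  then have "S \<subseteq> {..<k}" "l \<le> card S"
    using assms by (auto simp: Grassmann_def degree_at_least_def)
  then show False using assms(3) card_mono[of "{..<k}" S] by simp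
qed

lemma zero_in_Grassmann: "0 \<in> Grassmann k"
  and one_in_Grassmann: "1 \<in> Grassmann k"
  and generator_in_Grassmann: "j < k \<Longrightarrow> gmon {j} \<in> Grassmann k"
  by (auto simp: Grassmann_def gmon.rep_eq split: if_splits)

lemma Grassmann_add:
  assumes "a \<in> Grassmann k" "b \<in> Grassmann k"
  shows "a + b \<in> Grassmann k"
  unfolding Grassmann_def mem_Collect_eq
proof (intro allI impI)
  fix S assume "gcoeff (a + b) S \<noteq> 0"
  then have "gcoeff a S \<noteq> 0 \<or> gcoeff b S \<noteq> 0" by auto
  then show "S \<subseteq> {..<k}" using assms unfolding Grassmann_def by blast
qed

lemma Grassmann_scale: "a \<in> Grassmann k \<Longrightarrow> gr_scale c a \<in> Grassmann k"
  by (auto simp: Grassmann_def)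

lemma Grassmann_mult:
  fixes a b :: "'k::field grassmann"
  assumes "a \<in> Grassmann k" "b \<in> Grassmann k"
  shows "a * b \<in> Grassmann k"
  unfolding Grassmann_def mem_Collect_eq
proof (intro allI impI)
  fix S assume "gcoeff (a * b) S \<noteq> 0"
  then obtain T where T: "gcoeff a T \<noteq> 0" "gcoeff b (S - T) \<noteq> 0"
    by (rule gcoeff_mult_nonzeroE)
  then have "T \<subseteq> {..<k}" "S - T \<subseteq> {..<k}" using assms unfolding Grassmann_def by blast+
  then show "S \<subseteq> {..<k}" by blast
qed

lemma product_of_generators:
  assumes "distinct js"
  shows "\<exists>n. prod_list (map (\<lambda>j. gmon {j}) js) = (- 1) ^ n * (gmon (set js) :: 'k::field grassmann)"
  using assms
proof (induction js)
  case Nil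
  then show ?case by (intro exI[of _ 0]) (simp add: gmon_empty)
next
  case (Cons j js)
  then obtain n where n: "prod_list (map (\<lambda>j. gmon {j}) js) = (- 1) ^ n * (gmon (set js) :: 'k grassmann)"
    by auto
  have comm: "x * (- 1) ^ n = (- 1) ^ n * x" for x :: "'k grassmann"
    by (simp add: minus_one_power_iff)
  have "prod_list (map (\<lambda>j. gmon {j}) (j # js)) = (- 1) ^ n * (gmon {j} * (gmon (set js) :: 'k grassmann))"
    by (simp add: n mult.assoc[symmetric] comm)
  also have "gmon {j} * (gmon (set js) :: 'k grassmann) = (- 1) ^ inversions {j} (set js) * gmon (set (j # js))"
    using Cons.prems by (simp add: gmon_mult)
  finally show ?case by (metis mult.assoc power_add)
qed

lemma product_of_generators_nonzero:
  assumes "distinct js"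
  shows "prod_list (map (\<lambda>j. gmon {j}) js) \<noteq> (0 :: 'k::field grassmann)"
proof
  assume z: "prod_list (map (\<lambda>j. gmon {j}) js) = (0 :: 'k grassmann)"
  obtain n where "prod_list (map (\<lambda>j. gmon {j}) js) = (- 1) ^ n * (gmon (set js) :: 'k grassmann)"
    using product_of_generators[OF assms] by blast
  then have "gmon (set js) = (0 :: 'k grassmann)"
    using z by (simp add: minus_one_power_iff split: if_splits)
  then have "gcoeff (gmon (set js)) (set js) = (0 :: 'k)" by simp
  then show False by (simp add: gmon.rep_eq)
qed

section \<open>Substitutions into upper triangular matrices\<close>

definition e11 :: "'a::zero ut2 \<Rightarrow> 'a" where "e11 M = mat_of_ut2 M $ 1 $ 1"
definition e12 :: "'a::zero ut2 \<Rightarrow> 'a" where "e12 M = mat_of_ut2 M $ 1 $ 2"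
definition e22 :: "'a::zero ut2 \<Rightarrow> 'a" where "e22 M = mat_of_ut2 M $ 2 $ 2"

lemma mat_of_ut2_lower [simp]: "mat_of_ut2 M $ 2 $ 1 = 0"
  using mat_of_ut2[of M] by simp

lemma ut2_eqI:
  assumes "e11 M = e11 N" "e12 M = e12 N" "e22 M = e22 N"
  shows "M = N"
proof -
  have "mat_of_ut2 M = mat_of_ut2 N"
    using assms by (simp add: vec_eq_iff forall_2 e11_def e12_def e22_def)
  then show ?thesis by (simp add: mat_of_ut2_inject)
qed

lemma ut2_entries [simp]:
  fixes M N :: "'a::ring_1 ut2"
  shows "e11 (0 :: 'a ut2) = 0" "e12 (0 :: 'a ut2) = 0" "e22 (0 :: 'a ut2) = 0"
    "e11 (1 :: 'a ut2) = 1" "e12 (1 :: 'a ut2) = 0" "e22 (1 :: 'a ut2) = 1"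
    "e11 (M + N) = e11 M + e11 N" "e12 (M + N) = e12 M + e12 N" "e22 (M + N) = e22 M + e22 N"
    "e11 (M - N) = e11 M - e11 N" "e12 (M - N) = e12 M - e12 N" "e22 (M - N) = e22 M - e22 N"
    "e11 (M * N) = e11 M * e11 N" "e12 (M * N) = e11 M * e12 N + e12 M * e22 N" "e22 (M * N) = e22 M * e22 N"
  by (simp_all add: e11_def e12_def e22_def zero_ut2.rep_eq one_ut2.rep_eq mat_def plus_ut2.rep_eq
      minus_ut2.rep_eq times_ut2.rep_eq matrix_matrix_mult_def sum_2)

lemma ut2_scale_entries [simp]:
  "e11 (ut2_scale c M) = gr_scale c (e11 M)" "e12 (ut2_scale c M) = gr_scale c (e12 M)"
  "e22 (ut2_scale c M) = gr_scale c (e22 M)"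
  by (simp_all add: e11_def e12_def e22_def ut2_scale.rep_eq)

lemma in_UT2_iff:
  assumes "0 \<in> R"
  shows "M \<in> UT2 R \<longleftrightarrow> e11 M \<in> R \<and> e12 M \<in> R \<and> e22 M \<in> R"
  using assms by (auto simp: UT2_def forall_2 e11_def e12_def e22_def)

lift_definition triangular :: "'a::zero \<Rightarrow> 'a \<Rightarrow> 'a \<Rightarrow> 'a ut2" is
  "\<lambda>a n b. \<chi> i j. if i = 1 then (if j = 1 then a else n) else (if j = 1 then 0 else b)"
  by simp

lemma triangular_entries [simp]:
  "e11 (triangular a n b) = a" "e12 (triangular a n b) = n" "e22 (triangular a n b) = b"
  by (simp_all add: e11_def e12_def e22_def triangular.rep_eq)

lemma eval_diagonal:
  "e11 (eval ut2_scale \<phi> f) = eval gr_scale (\<lambda>i. e11 (\<phi> i)) f"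
  "e22 (eval ut2_scale \<phi> f) = eval gr_scale (\<lambda>i. e22 (\<phi> i)) f"
proof -
  have p: "e11 (prod_list (map \<phi> l)) = prod_list (map (\<lambda>i. e11 (\<phi> i)) l)"
    "e22 (prod_list (map \<phi> l)) = prod_list (map (\<lambda>i. e22 (\<phi> i)) l)" for l
    by (induction l) auto
  show "e11 (eval ut2_scale \<phi> f) = eval gr_scale (\<lambda>i. e11 (\<phi> i)) f"
    by (induction f rule: free_algebra_induct) (simp_all add: ut2.eval_single gr.eval_single ut2.eval_add gr.eval_add p)
  show "e22 (eval ut2_scale \<phi> f) = eval gr_scale (\<lambda>i. e22 (\<phi> i)) f"
    by (induction f rule: free_algebra_induct) (simp_all add: ut2.eval_single gr.eval_single ut2.eval_add gr.eval_add p)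
qed

lemma eval_in_UT2:
  assumes "range \<phi> \<subseteq> UT2 (Grassmann k)"
  shows "eval ut2_scale \<phi> f \<in> UT2 (Grassmann k)"
proof (rule ut2.eval_in_subalgebra)
  show "\<phi> i \<in> UT2 (Grassmann k)" for i using assms by auto
qed (auto simp: in_UT2_iff zero_in_Grassmann one_in_Grassmann Grassmann_add Grassmann_mult Grassmann_scale)

lemma T_ideal_identities:
  "T_ideal (identities (ut2_scale :: 'k::field \<Rightarrow> _) (UT2 (Grassmann k)))"
  unfolding T_ideal_def
proof (intro conjI allI impI subsetI)
  show "two_sided_ideal (identities (ut2_scale :: 'k \<Rightarrow> _) (UT2 (Grassmann k)))"
    by (auto simp: two_sided_ideal_def identities_def ut2.eval_zero ut2.eval_add ut2.eval_mult)
next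
  fix h and g :: "'k free_algebra"
  assume h: "endomorphism h" and "g \<in> h ` identities ut2_scale (UT2 (Grassmann k))"
  then obtain f where f: "f \<in> identities ut2_scale (UT2 (Grassmann k))" and g: "g = h f" by blast
  show "g \<in> identities ut2_scale (UT2 (Grassmann k))"
    unfolding identities_def mem_Collect_eq
  proof (intro allI impI)
    fix \<phi> :: "nat \<Rightarrow> 'k grassmann ut2" assume \<phi>: "range \<phi> \<subseteq> UT2 (Grassmann k)"
    have "range (\<lambda>i. eval ut2_scale \<phi> (h (var i))) \<subseteq> UT2 (Grassmann k)"
      using eval_in_UT2[OF \<phi>] by blast
    then have "eval ut2_scale (\<lambda>i. eval ut2_scale \<phi> (h (var i))) f = 0"
      using f unfolding identities_def by blast
    moreover have "eval ut2_scale \<phi> (h f) = eval ut2_scale (\<lambda>i. eval ut2_scale \<phi> (h (var i))) f"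
      by (rule eval_endomorphism[OF ut2.unital_algebra_axioms h])
    ultimately show "eval ut2_scale \<phi> g = 0" by (simp only: g)
  qed
qed

lemma ut2_long_commutator_diagonal:
  fixes a b c :: "'k::field grassmann ut2"
  shows "e11 (commutator (commutator a b) c) = 0" "e22 (commutator (commutator a b) c) = 0"
proof -
  have "e11 (commutator x y) = commutator (e11 x) (e11 y)" "e22 (commutator x y) = commutator (e22 x) (e22 y)"
    for x y :: "'k grassmann ut2" by (simp_all add: commutator_def)
  then show "e11 (commutator (commutator a b) c) = 0" "e22 (commutator (commutator a b) c) = 0"
    by (simp_all add: grassmann_long_commutator)
qed

lemma long_long_identity:
  "commutator (commutator (var 1) (var 2)) (var 3) * commutator (commutator (var 4) (var 5)) (var 6)
    \<in> identities ut2_scale (UT2 (Grassmann k))"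
  unfolding identities_def mem_Collect_eq
  by (intro allI impI ut2_eqI)
    (simp_all add: ut2.eval_mult ut2.eval_commutator ut2_long_commutator_diagonal)

text \<open>
  Each summand of the upper right entry of a product involves the upper right entry of exactly one factor;
  the diagonal entries of the others contribute degree 2 each. The truncated subtraction gives the
  correct bound \<open>0\<close> for the empty product.
\<close>

lemma product_of_commutators_degree:
  fixes ps :: "('k::field grassmann ut2 \<times> 'k grassmann ut2) list"
  defines "P \<equiv> prod_list (map (\<lambda>(a, b). commutator a b) ps)"
  shows "e11 P \<in> degree_at_least (2 * length ps) \<and> e22 P \<in> degree_at_least (2 * length ps) \<and>
    e12 P \<in> degree_at_least (2 * length ps - 2)"
  unfolding P_def
proof (induction ps)
  case Nil
  show ?case by (auto simp: degree_at_least_def)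
next
  case (Cons p ps)
  obtain a b where p: "p = (a, b)" by (cases p)
  define Q where "Q = prod_list (map (\<lambda>(a, b). commutator a b) ps)"
  have Q: "e11 Q \<in> degree_at_least (2 * length ps)" "e22 Q \<in> degree_at_least (2 * length ps)"
    "e12 Q \<in> degree_at_least (2 * length ps - 2)" using Cons.IH by (auto simp: Q_def)
  have c: "e11 (commutator a b) \<in> degree_at_least 2" "e22 (commutator a b) \<in> degree_at_least 2"
    using commutator_degree[of "e11 a" "e11 b"] commutator_degree[of "e22 a" "e22 b"]
    by (simp_all add: commutator_def)
  have "e12 (commutator a b) \<in> degree_at_least 0" by (simp add: degree_at_least_def)
  then have "e12 (commutator a b) * e22 Q \<in> degree_at_least (2 * length (p # ps) - 2)"
    using degree_at_least_mult[OF _ Q(2)] by fastforce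
  moreover have "e11 (commutator a b) * e12 Q \<in> degree_at_least (2 * length (p # ps) - 2)"
    by (rule degree_at_least_mono[OF _ degree_at_least_mult[OF c(1) Q(3)]]) simp
  ultimately have "e12 (commutator a b * Q) \<in> degree_at_least (2 * length (p # ps) - 2)"
    by (simp add: degree_at_least_add)
  then show ?case
    using degree_at_least_mult[OF c(1) Q(1)] degree_at_least_mult[OF c(2) Q(2)] by (simp add: p Q_def)
qed

lemma many_commutators_identity:
  "prod_list (map (\<lambda>i. commutator (var (2 * i + 1)) (var (2 * i + 2))) [0..<m + 2])
    \<in> identities ut2_scale (UT2 (Grassmann (2 * m)))"
  unfolding identities_def mem_Collect_eq
proof (intro allI impI)
  fix \<phi> :: "nat \<Rightarrow> 'a grassmann ut2" assume \<phi>: "range \<phi> \<subseteq> UT2 (Grassmann (2 * m))"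
  let ?f = "prod_list (map (\<lambda>i. commutator (var (2 * i + 1)) (var (2 * i + 2))) [0..<m + 2]) :: 'a free_algebra"
  define ps where "ps = map (\<lambda>i. (\<phi> (2 * i + 1), \<phi> (2 * i + 2))) [0..<m + 2]"
  have f: "eval ut2_scale \<phi> ?f = prod_list (map (\<lambda>(a, b). commutator a b) ps)"
    by (simp add: ps_def ut2.eval_prod_list ut2.eval_mult ut2.eval_commutator ut2.eval_var o_def)
  have len: "length ps = m + 2" by (simp add: ps_def)
  have inG: "e11 (eval ut2_scale \<phi> ?f) \<in> Grassmann (2 * m)" "e12 (eval ut2_scale \<phi> ?f) \<in> Grassmann (2 * m)"
    "e22 (eval ut2_scale \<phi> ?f) \<in> Grassmann (2 * m)"
    using eval_in_UT2[OF \<phi>, of ?f] unfolding in_UT2_iff[OF zero_in_Grassmann] by auto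
  show "eval ut2_scale \<phi> ?f = 0"
    using product_of_commutators_degree[of ps] inG unfolding f len
    by (intro ut2_eqI) (auto intro: Grassmann_degree_zero)
qed

section \<open>Separating evaluations\<close>

lemma commutator_trivial:
  fixes x :: "'a::ring_1"
  assumes "x \<in> {0, 1}"
  shows "commutator x y = 0" "commutator y x = 0"
  using assms by (auto simp: commutator_def)

text \<open>
  In a list of even length every letter belongs to one of the commutators.
\<close>

lemma (in unital_algebra) eval_pair_product_trivial:
  assumes "even (length c)" "j \<in> set c" "\<phi> j \<in> {0, 1}"
  shows "eval smul \<phi> (pair_product c) = 0"
  using assms(1,2)
proof (induction c rule: pair_product.induct)
  case (1 x y c)
  show ?case
  proof (cases "j \<in> set c")
    case False
    then have "j = x \<or> j = y" using 1 by auto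
    then have "commutator (\<phi> x) (\<phi> y) = 0" using commutator_trivial[OF assms(3)] by auto
    then show ?thesis by (simp add: eval_mult eval_commutator eval_var)
  qed (use 1 in \<open>simp add: eval_mult\<close>)
qed auto

text \<open>
  Generators anticommute, so \<open>[e\<^sub>k, e\<^sub>l] = 2 e\<^sub>k e\<^sub>l\<close>.
\<close>

lemma eval_pair_product_generators:
  assumes "even (length c)" "\<And>j. j \<in> set c \<Longrightarrow> \<phi> j = gmon {\<iota> j}"
  shows "eval gr_scale \<phi> (pair_product c)
    = gr_scale (2 ^ (length c div 2)) (prod_list (map (\<lambda>j. gmon {j}) (map \<iota> c)) :: 'k::field grassmann)"
  using assms
proof (induction c rule: pair_product.induct)
  case (1 x y c)
  let ?x = "gmon {\<iota> x} :: 'k grassmann" and ?y = "gmon {\<iota> y} :: 'k grassmann"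
  have "commutator ?x ?y = ?x * ?y + ?x * ?y"
    using generator_anticommute[of "\<iota> y" "\<iota> x", where 'a = 'k] by (simp add: commutator_def)
  also have "\<dots> = gr_scale 2 (?x * ?y)"
    using gr.scale_left_distrib[of 1 1 "?x * ?y"] by simp
  finally show ?case
    using 1 by (simp add: gr.eval_mult gr.eval_commutator gr.eval_var gr.mult_scale_left gr.mult_scale_right mult.assoc)
qed (simp_all add: gr.eval_one)

lemma eval_long_left_normed_diagonal:
  assumes "3 \<le> length l"
  shows "e11 (eval ut2_scale \<phi> (left_normed l)) = 0" "e22 (eval ut2_scale \<phi> (left_normed l)) = 0"
proof -
  obtain u v w where "left_normed l = (commutator (commutator u v) w :: 'a free_algebra)"
    by (rule left_normed_is_long_commutator[OF assms])
  then show "e11 (eval ut2_scale \<phi> (left_normed l)) = 0" "e22 (eval ut2_scale \<phi> (left_normed l)) = 0"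
    by (simp_all add: ut2.eval_commutator ut2_long_commutator_diagonal)
qed

lemma diagonal_left_normed:
  fixes \<phi> :: "nat \<Rightarrow> 'k::field grassmann ut2"
  assumes "l \<noteq> []" "\<And>j. j \<in> set l \<Longrightarrow> e12 (\<phi> j) = 0"
  shows "e12 (eval ut2_scale \<phi> (left_normed l)) = 0"
proof -
  have "e12 (foldl (\<lambda>u i. commutator u (\<phi> i)) u l') = 0"
    if "e12 u = 0" "\<And>j. j \<in> set l' \<Longrightarrow> e12 (\<phi> j) = 0" for u l'
    using that by (induction l' arbitrary: u) (simp_all add: commutator_def)
  then show ?thesis
    unfolding ut2.eval_left_normed using assms by (cases l) auto
qed

text \<open>
  The data of a normal form \<open>(C, R, i, D)\<close>, with generators of the Grassmann algebra chosen for the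
  letters in \<open>C\<close> and \<open>D\<close>.
\<close>

locale separating_point =
  fixes \<iota> :: "nat \<Rightarrow> nat" and C R D :: "nat set" and i :: nat and n :: nat
  assumes disjoint: "C \<inter> R = {}" "C \<inter> D = {}" "R \<inter> D = {}"
    and i: "i \<in> R" "i \<noteq> Min R" and R: "finite R" "3 \<le> card R"
    and inj: "inj_on \<iota> (C \<union> D)" "\<iota> ` (C \<union> D) \<subseteq> {..<n}"
    and finCD: "finite C" "finite D" and evenCD: "even (card C)" "even (card D)"
begin

definition point :: "nat \<Rightarrow> 'k::field grassmann ut2" where
  "point j = (if j \<in> C then triangular (gmon {\<iota> j}) 0 0 else if j \<in> D then triangular 0 0 (gmon {\<iota> j})
    else if j = i then triangular 0 1 0 else triangular 1 0 0)"

lemma point_in_UT2: "range point \<subseteq> UT2 (Grassmann n)"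
  using inj(2) by (auto simp: in_UT2_iff zero_in_Grassmann one_in_Grassmann generator_in_Grassmann point_def image_subset_iff)

lemma point_R: "j \<in> R - {i} \<Longrightarrow> point j = triangular 1 0 0"
  and point_i: "point i = triangular 0 1 0"
  using disjoint i(1) by (auto simp: point_def)

lemma point_diagonal: "j \<noteq> i \<Longrightarrow> e12 (point j) = 0"
  by (simp add: point_def)

lemma commutator_R:
  assumes "j \<in> R - {i}" "k \<noteq> i"
  shows "commutator (point j) (point k) = (0 :: 'k::field grassmann ut2)"
    and "commutator (point k) (point j) = (0 :: 'k grassmann ut2)"
  using point_diagonal[OF assms(2)] by (auto simp: point_R[OF assms(1)] commutator_def intro!: ut2_eqI)

lemma eval_pair_product_one_R:
  assumes "even (length c)" "j \<in> set c" "j \<in> R - {i}" "i \<notin> set c"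
  shows "eval ut2_scale point (pair_product c) = 0"
  using assms(1,2,4)
proof (induction c rule: pair_product.induct)
  case (1 x y c)
  show ?case
  proof (cases "j \<in> set c")
    case False
    then have "j = x \<or> j = y" using 1 by auto
    then have "commutator (point x) (point y) = (0 :: 'a grassmann ut2)"
      using commutator_R[OF assms(3), of x, where 'k = 'a] commutator_R[OF assms(3), of y, where 'k = 'a] 1 by auto
    then show ?thesis by (simp add: ut2.eval_mult ut2.eval_commutator ut2.eval_var)
  qed (use 1 in \<open>simp add: ut2.eval_mult\<close>)
qed auto

text \<open>
  Two letters of \<open>R - {i}\<close> cannot both be paired with \<open>i\<close>, and one of them paired with any other
  letter gives a vanishing commutator.
\<close>

lemma eval_pair_product_two_R:
  assumes "even (length c)" "distinct c" "j \<in> set c" "j \<in> R - {i}" "k \<in> set c" "k \<in> R - {i}" "j \<noteq> k"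
  shows "eval ut2_scale point (pair_product c) = 0"
  using assms(1,2,3,5)
proof (induction c rule: pair_product.induct)
  case (1 x y c)
  consider "j \<in> set c" "k \<in> set c" | "j \<in> {x, y}" "i \<notin> {x, y}" | "k \<in> {x, y}" "i \<notin> {x, y}"
    | "j \<in> {x, y}" "i \<in> {x, y}" | "k \<in> {x, y}" "i \<in> {x, y}"
    using 1 by auto
  then show ?case
  proof cases
    case 1
    then show ?thesis using "1.IH" "1.prems" by (simp add: ut2.eval_mult)
  next
    case 2
    then have "commutator (point x) (point y) = (0 :: 'a grassmann ut2)"
      using commutator_R[OF assms(4), of x, where 'k = 'a] commutator_R[OF assms(4), of y, where 'k = 'a] by auto
    then show ?thesis by (simp add: ut2.eval_mult ut2.eval_commutator ut2.eval_var)
  next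
    case 3
    then have "commutator (point x) (point y) = (0 :: 'a grassmann ut2)"
      using commutator_R[OF assms(6), of x, where 'k = 'a] commutator_R[OF assms(6), of y, where 'k = 'a] by auto
    then show ?thesis by (simp add: ut2.eval_mult ut2.eval_commutator ut2.eval_var)
  next
    case 4
    then have "k \<in> set c" "i \<notin> set c" using "1.prems" assms(4,6,7) by auto
    then show ?thesis
      using "1.prems" assms(6) by (simp add: ut2.eval_mult eval_pair_product_one_R[of c k])
  next
    case 5
    then have "j \<in> set c" "i \<notin> set c" using "1.prems" assms(4,6,7) by auto
    then show ?thesis
      using "1.prems" assms(4) by (simp add: ut2.eval_mult eval_pair_product_one_R[of c j])
  qed
qed auto

lemma eval_pair_products:
  assumes "f \<in> pair_products V" "R \<subseteq> V"
  shows "eval ut2_scale point f = 0"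
proof -
  obtain c where f: "f = pair_product c" and c: "even (length c)" "distinct c" "set c = V"
    using assms(1) by (auto simp: pair_products_def)
  have "2 \<le> card (R - {i})" using R i(1) by simp
  then obtain j k where "j \<in> R - {i}" "k \<in> R - {i}" "j \<noteq> k"
    by (meson card_2_iff' obtain_subset_with_card_n subsetD)
  then show ?thesis
    unfolding f using c assms(2) by (intro eval_pair_product_two_R[of c j k]) auto
qed

text \<open>
  The diagonal of the long factor is zero, so only its upper right entry contributes to that of the
  product.
\<close>

lemma eval_normal_form:
  assumes "finite R'" "3 \<le> card R'" "i' \<in> R'"
  shows "e12 (eval ut2_scale point (normal_form (C', R', i', D')))
    = eval gr_scale (\<lambda>j. e11 (point j)) (pair_product (sorted_list_of_set C'))
      * e12 (eval ut2_scale point (left_normed (i' # sorted_list_of_set (R' - {i'}))))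
      * eval gr_scale (\<lambda>j. e22 (point j)) (pair_product (sorted_list_of_set D'))"
proof -
  have len: "3 \<le> length (i' # sorted_list_of_set (R' - {i'}))" using assms by simp
  show ?thesis
    by (simp add: normal_form_def ut2.eval_mult eval_long_left_normed_diagonal[OF len] distrib_right)
      (simp add: eval_diagonal)
qed

text \<open>
  Each letter of \<open>R - {i}\<close> changes the sign of \<open>E\<^sub>1\<^sub>2\<close>, so the long factor evaluates to \<open>E\<^sub>1\<^sub>2\<close> up to sign, and
  the value is a product of distinct generators times a power of 2 up to sign.
\<close>

lemma eval_own_normal_form:
  "e12 (eval ut2_scale point (normal_form (C, R, i, D))) \<noteq> (0 :: 'k::field_char_0 grassmann)"
proof -
  let ?R = "sorted_list_of_set (R - {i})" and ?C = "sorted_list_of_set C" and ?D = "sorted_list_of_set D"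
  have fold: "foldl (\<lambda>u j. commutator u (point j)) (triangular 0 a 0) l = triangular 0 ((- 1) ^ length l * a) 0"
    if "set l \<subseteq> R - {i}" for l and a :: "'k grassmann"
    using that
  proof (induction l arbitrary: a)
    case (Cons j l)
    have "commutator (triangular 0 a 0) (point j) = triangular 0 (- a) 0"
      using Cons.prems point_R[of j, where 'a = 'k] by (auto simp: commutator_def intro!: ut2_eqI)
    then show ?case using Cons by simp
  qed simp
  have L: "e12 (eval ut2_scale point (left_normed (i # ?R))) = ((- 1) ^ length ?R :: 'k grassmann)"
    using R fold[of ?R 1] by (simp add: ut2.eval_left_normed point_i)
  have C: "eval gr_scale (\<lambda>j. e11 (point j)) (pair_product ?C)
    = gr_scale (2 ^ (card C div 2)) (prod_list (map (\<lambda>j. gmon {j}) (map \<iota> ?C)) :: 'k grassmann)"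
    using finCD evenCD by (subst eval_pair_product_generators[where \<iota> = \<iota>]) (auto simp: point_def)
  have D: "eval gr_scale (\<lambda>j. e22 (point j)) (pair_product ?D)
    = gr_scale (2 ^ (card D div 2)) (prod_list (map (\<lambda>j. gmon {j}) (map \<iota> ?D)) :: 'k grassmann)"
    using finCD evenCD disjoint by (subst eval_pair_product_generators[where \<iota> = \<iota>]) (auto simp: point_def)
  let ?X = "prod_list (map (\<lambda>j. gmon {j}) (map \<iota> (?C @ ?D))) :: 'k grassmann"
  have "\<iota> ` C \<inter> \<iota> ` D = {}" "inj_on \<iota> C" "inj_on \<iota> D"
    using inj(1) disjoint(2) by (auto simp: inj_on_Un Diff_triv Int_commute)
  then have "distinct (map \<iota> (?C @ ?D))"
    using finCD by (simp add: distinct_map)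
  then have X: "?X \<noteq> 0" by (rule product_of_generators_nonzero)
  have sgn: "x * (- 1) ^ k * y = (- 1) ^ k * (x * y)" for x y :: "'k grassmann" and k
    by (simp add: minus_one_power_iff)
  have "e12 (eval ut2_scale point (normal_form (C, R, i, D)))
    = (- 1) ^ length ?R * gr_scale (2 ^ (card C div 2) * 2 ^ (card D div 2)) ?X"
    unfolding eval_normal_form[OF R i(1)] L C D sgn
    by (simp add: gr.mult_scale_left gr.mult_scale_right mult.commute)
  then show ?thesis using X by (simp add: minus_one_power_iff)
qed

text \<open>
  If \<open>i\<close> is not in the long factor, that factor is a commutator of diagonal matrices and has no
  upper right entry. If a letter of \<open>R\<close> is missing from it, that letter occurs in one of the outer products as a
  scalar on the relevant diagonal entry. Otherwise \<open>R' = R\<close> by the bound on the cardinality, and either the long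
  factor begins with \<open>[E\<^sub>1\<^sub>1, E\<^sub>1\<^sub>1]\<close>, or one of the outer products contains a letter which is zero on the
  relevant diagonal entry.
\<close>

lemma eval_other_normal_form:
  assumes q: "(C', R', i', D') \<in> normal_form_indices m (C \<union> R \<union> D)"
    and le: "card R' \<le> card R" and neq: "(C', R', i', D') \<noteq> (C, R, i, D)"
  shows "e12 (eval ut2_scale point (normal_form (C', R', i', D'))) = (0 :: 'k::field grassmann)"
proof -
  have U: "C' \<union> R' \<union> D' = C \<union> R \<union> D" and dis: "C' \<inter> R' = {}" "C' \<inter> D' = {}" "R' \<inter> D' = {}"
    and ev: "even (card C')" "even (card D')" and R': "3 \<le> card R'" "i' \<in> R'" "i' \<noteq> Min R'"
    using q by (auto simp: normal_form_indices_def)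
  have "finite (C' \<union> R' \<union> D')" using finCD R by (simp add: U)
  then have fin: "finite C'" "finite R'" "finite D'" by auto
  let ?R = "i' # sorted_list_of_set (R' - {i'})"
  have setR: "set ?R = R'" using fin R' by auto
  have left: ?thesis if "j \<in> C'" "e11 (point j) \<in> {0, 1 :: 'k grassmann}" for j
    unfolding eval_normal_form[OF fin(2) R'(1,2)]
    using gr.eval_pair_product_trivial[of "sorted_list_of_set C'" j "\<lambda>j. e11 (point j) :: 'k grassmann"] that fin ev by simp
  have right: ?thesis if "j \<in> D'" "e22 (point j) \<in> {0, 1 :: 'k grassmann}" for j
    unfolding eval_normal_form[OF fin(2) R'(1,2)]
    using gr.eval_pair_product_trivial[of "sorted_list_of_set D'" j "\<lambda>j. e22 (point j) :: 'k grassmann"] that fin ev by simp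
  have middle: ?thesis if "e12 (eval ut2_scale point (left_normed ?R)) = (0 :: 'k grassmann)"
    unfolding eval_normal_form[OF fin(2) R'(1,2)] that by simp
  consider "i \<notin> R'" | j where "i \<in> R'" "j \<in> R" "j \<notin> R'" | "i \<in> R'" "R \<subseteq> R'" by blast
  then show ?thesis
  proof cases
    case 1
    have "e12 (eval ut2_scale point (left_normed ?R)) = (0 :: 'k grassmann)"
    proof (rule diagonal_left_normed)
      fix j assume "j \<in> set ?R"
      then have "j \<noteq> i" using 1 setR by blast
      then show "e12 (point j) = (0 :: 'k grassmann)" by (rule point_diagonal)
    qed simp
    then show ?thesis by (rule middle)
  next
    case 2
    then have j: "j \<in> R - {i}" by auto
    have "j \<in> C' \<or> j \<in> D'" using 2 U by auto
    then show ?thesis using left[of j] right[of j] point_R[OF j, where 'a = 'k] by auto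
  next
    case 3
    then have RR: "R' = R" using le fin R by (metis card_seteq)
    show ?thesis
    proof (cases "i' = i")
      case False
      let ?m = "Min R"
      have mR: "?m \<in> R" using R by (intro Min_in) auto
      have ne: "sorted_list_of_set (R - {i'}) = ?m # sorted_list_of_set (R - {i'} - {?m})"
      proof -
        have ne0: "R - {i'} \<noteq> {}" using mR R'(3) RR by auto
        have "Min (R - {i'}) = ?m"
          by (rule Min_eqI) (use R R'(3) RR mR in auto)
        then show ?thesis
          using sorted_list_of_set_nonempty[OF _ ne0] R by simp
      qed
      have "commutator (point i') (point ?m) = (0 :: 'k grassmann ut2)"
        by (rule commutator_R) (use False R' RR i in auto)
      moreover have "foldl (\<lambda>u i. commutator u (point i)) 0 l = (0 :: 'k grassmann ut2)" for l
        by (induction l) (simp_all add: commutator_def)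
      ultimately have "eval ut2_scale point (left_normed ?R) = (0 :: 'k grassmann ut2)"
        unfolding RR ne by (simp add: ut2.eval_left_normed)
      then show ?thesis by (intro middle) simp
    next
      case True
      have "C' \<union> D' = C \<union> D" using U dis disjoint RR by auto
      moreover have "C' \<noteq> C \<or> D' \<noteq> D" using neq RR True by auto
      ultimately obtain j where "j \<in> C' \<inter> D \<or> j \<in> D' \<inter> C" using dis disjoint by blast
      then show ?thesis
      proof
        assume "j \<in> C' \<inter> D"
        then show ?thesis using disjoint by (intro left[of j]) (auto simp: point_def)
      next
        assume "j \<in> D' \<inter> C"
        then show ?thesis using disjoint by (intro right[of j]) (auto simp: point_def)
      qed
    qed
  qed
qed

end

lemma finite_normal_form_indices: "finite V \<Longrightarrow> finite (normal_form_indices m V)"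
  by (rule finite_subset[of _ "Pow V \<times> Pow V \<times> V \<times> Pow V"]) (auto simp: normal_form_indices_def)

lemma span_image_representation:
  assumes "finite Q" "x \<in> fa.span (F ` Q)"
  obtains c where "x = (\<Sum>q\<in>Q. fa_scale (c q) (F q))"
proof -
  have "\<exists>c. x = (\<Sum>q\<in>Q. fa_scale (c q) (F q))"
    using assms(2)
  proof (induction rule: fa.span_induct_alt)
    case base
    show ?case by (rule exI[of _ "\<lambda>_. 0"]) simp
  next
    case (step a y x)
    then obtain p c where p: "p \<in> Q" "y = F p" and x: "x = (\<Sum>q\<in>Q. fa_scale (c q) (F q))" by blast
    define c' where "c' q = (if q = p then a else 0) + c q" for q
    have "(\<Sum>q\<in>Q. fa_scale (c' q) (F q)) = (\<Sum>q\<in>Q. if q = p then fa_scale a (F q) else 0) + x"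
      unfolding x sum.distrib[symmetric] by (rule sum.cong) (auto simp: c'_def fa.scale_left_distrib)
    then have "fa_scale a y + x = (\<Sum>q\<in>Q. fa_scale (c' q) (F q))" using p assms(1) by simp
    then show ?case by blast
  qed
  then show ?thesis using that by blast
qed

text \<open>
  Evaluation at the separating point of a normal form with nonzero coefficient and longest possible long factor
  leaves this normal form only. The \<open>2 * m\<close> generators suffice for its letters outside of the long factor
  by the bound on \<open>card C + card D\<close> in the definition of the indices.
\<close>

lemma normal_form_coefficients_zero:
  fixes f p :: "'k::field_char_0 free_algebra"
  assumes V: "finite V" and p: "p \<in> fa.span (pair_products V)"
    and identity: "p + (\<Sum>q\<in>normal_form_indices m V. fa_scale (c q) (normal_form q))
      \<in> identities ut2_scale (UT2 (Grassmann (2 * m)))"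
    and q: "q \<in> normal_form_indices m V"
  shows "c q = 0"
proof (rule ccontr)
  assume "c q \<noteq> 0"
  let ?Q = "normal_form_indices m V"
  define S where "S = {q \<in> ?Q. c q \<noteq> 0}"
  define size where "size = (\<lambda>(C :: nat set, R :: nat set, i :: nat, D :: nat set). card R)"
  have "q \<in> S" using q \<open>c q \<noteq> 0\<close> by (simp add: S_def)
  then have S: "finite S" "S \<noteq> {}"
    using finite_normal_form_indices[OF V] by (simp add: S_def, blast)
  then have "Max (size ` S) \<in> size ` S" by (intro Max_in) auto
  then obtain r where r: "r \<in> S" "size r = Max (size ` S)" by auto
  have max: "size q \<le> size r" if "q \<in> S" for q unfolding r(2) using that S by (intro Max_ge) auto
  obtain C R i D where r_eq: "r = (C, R, i, D)" by (cases r)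
  have r_idx: "(C, R, i, D) \<in> ?Q" "c (C, R, i, D) \<noteq> 0" using r(1) by (auto simp: S_def r_eq)
  then have U: "C \<union> R \<union> D = V" and props: "C \<inter> R = {}" "C \<inter> D = {}" "R \<inter> D = {}" "even (card C)" "even (card D)"
    "card C + card D \<le> 2 * m" "3 \<le> card R" "i \<in> R" "i \<noteq> Min R"
    by (auto simp: normal_form_indices_def)
  have "finite (C \<union> R \<union> D)" using V U by simp
  then have fin: "finite C" "finite R" "finite D" by auto
  have "card (C \<union> D) \<le> card {..<2 * m}" using fin props by (simp add: card_Un_disjoint)
  then obtain \<iota> where \<iota>: "\<iota> ` (C \<union> D) \<subseteq> {..<2 * m}" "inj_on \<iota> (C \<union> D)"
    using card_le_inj[of "C \<union> D" "{..<2 * m}"] fin by auto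
  interpret separating_point \<iota> C R D i "2 * m"
    by unfold_locales (use \<iota> fin props in auto)
  let ?ev = "\<lambda>f. e12 (eval ut2_scale point f) :: 'k grassmann"
  have "eval ut2_scale point p = (0 :: 'k grassmann ut2)"
    using p
  proof (induction rule: fa.span_induct_alt)
    case base
    show ?case by (rule ut2.eval_zero)
  next
    case (step a x y)
    then have "eval ut2_scale point x = (0 :: 'k grassmann ut2)"
      using U by (intro eval_pair_products[of x V]) auto
    then show ?case using step by (simp add: ut2.eval_add ut2.eval_scale)
  qed
  then have "?ev (p + (\<Sum>q\<in>?Q. fa_scale (c q) (normal_form q))) = ?ev (\<Sum>q\<in>?Q. fa_scale (c q) (normal_form q))"
    by (simp add: ut2.eval_add)
  also have "\<dots> = (\<Sum>q\<in>?Q. gr_scale (c q) (?ev (normal_form q)))"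
  proof -
    have "e12 (sum F X) = (\<Sum>x\<in>X. e12 (F x))" for F :: "nat set \<times> nat set \<times> nat \<times> nat set \<Rightarrow> 'k grassmann ut2" and X
      by (induction X rule: infinite_finite_induct) auto
    then show ?thesis by (simp add: ut2.eval_sum ut2.eval_scale)
  qed
  also have "\<dots> = gr_scale (c (C, R, i, D)) (?ev (normal_form (C, R, i, D)))
      + (\<Sum>q\<in>?Q - {(C, R, i, D)}. gr_scale (c q) (?ev (normal_form q)))"
    by (rule sum.remove[OF finite_normal_form_indices[OF V] r_idx(1)])
  also have "(\<Sum>q\<in>?Q - {(C, R, i, D)}. gr_scale (c q) (?ev (normal_form q))) = 0"
  proof (rule sum.neutral, rule ballI)
    fix q assume q: "q \<in> ?Q - {(C, R, i, D)}"
    show "gr_scale (c q) (?ev (normal_form q)) = 0"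
    proof (cases "c q = 0")
      case False
      obtain C' R' i' D' where q_eq: "q = (C', R', i', D')" by (cases q)
      have "card R' \<le> card R" using max[of q] q False by (simp add: S_def size_def q_eq r_eq)
      then have "?ev (normal_form q) = 0"
        unfolding q_eq using q U by (intro eval_other_normal_form[where m = m]) (auto simp: q_eq)
      then show ?thesis by simp
    qed simp
  qed
  finally have "?ev (p + (\<Sum>q\<in>?Q. fa_scale (c q) (normal_form q)))
    = gr_scale (c (C, R, i, D)) (?ev (normal_form (C, R, i, D)))" by simp
  moreover have "eval ut2_scale point (p + (\<Sum>q\<in>?Q. fa_scale (c q) (normal_form q))) = (0 :: 'k grassmann ut2)"
    using identity point_in_UT2 unfolding identities_def by blast
  ultimately show False using r_idx(2) eval_own_normal_form[where 'k = 'k] by simp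
qed

section \<open>The identities of the upper triangular matrices\<close>

lemma pair_product_in_commutator_products:
  assumes "even (length c)" "c \<noteq> []"
  shows "(pair_product c :: 'k::field free_algebra) \<in> commutator_products"
proof -
  obtain ps where ps: "length ps = length c div 2"
    "(pair_product c :: 'k free_algebra) = prod_list (map (\<lambda>(i, j). commutator (var i) (var j)) ps)"
    by (rule pair_product_conv_commutators)
  have "ps \<noteq> []" using ps(1) assms by (auto elim!: evenE)
  then show ?thesis unfolding commutator_products_def ps(2) by blast
qed

text \<open>
  For \<open>V = {}\<close> the only product is the empty one, and a constant is an identity only if it is zero.
\<close>

lemma pair_products_identity:
  fixes p :: "'k::field free_algebra"
  assumes p: "p \<in> fa.span (pair_products V)" "p \<in> identities ut2_scale (UT2 (Grassmann (2 * m)))"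
  shows "p \<in> fa.span commutator_products"
proof (cases "V = {}")
  case False
  have "pair_products V \<subseteq> commutator_products"
    using False pair_product_in_commutator_products by (auto simp: pair_products_def)
  then show ?thesis using p(1) fa.span_mono by blast
next
  case True
  have "pair_products V = {1 :: 'k free_algebra}" unfolding pair_products_def True by auto
  then obtain c where c: "p = fa_scale c 1"
    using p(1) by (auto simp: fa.span_singleton)
  define \<phi> :: "nat \<Rightarrow> 'k grassmann ut2" where "\<phi> = (\<lambda>_. 0)"
  have "range \<phi> \<subseteq> UT2 (Grassmann (2 * m))"
    by (auto simp: \<phi>_def in_UT2_iff zero_in_Grassmann)
  then have "eval ut2_scale \<phi> p = 0" using p(2) by (auto simp: identities_def)
  then have "e11 (ut2_scale c (1 :: 'k grassmann ut2)) = e11 (0 :: 'k grassmann ut2)"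
    by (simp only: c ut2.eval_scale ut2.eval_one)
  then have "gr_scale c (1 :: 'k grassmann) = 0" by simp
  then have "gcoeff (gr_scale c (1 :: 'k grassmann)) {} = 0" by simp
  then have "c = 0" by simp
  then show ?thesis by (simp add: c fa.span_zero)
qed

lemma T_ideal_generated_minimal: "T_ideal I \<Longrightarrow> S \<subseteq> I \<Longrightarrow> T_ideal_generated S \<subseteq> I"
  and T_ideal_generated_base: "S \<subseteq> T_ideal_generated S"
  by (auto simp: T_ideal_generated_def)

lemma T_gen_identities:
  "T_gen m \<subseteq> identities ut2_scale (UT2 (Grassmann (2 * m)))"
  unfolding T_gen_def
  by (intro T_ideal_generated_minimal T_ideal_identities) (use long_long_identity many_commutators_identity in blast)

lemma proper_identity:
  fixes g :: "'k::field_char_0 free_algebra"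
  assumes V: "finite V" and g: "g \<in> proper V" "g \<in> identities ut2_scale (UT2 (Grassmann (2 * m)))"
  obtains p t where "g = p + t" "p \<in> commutator_identities m" "t \<in> T_gen m"
proof -
  interpret long_and_short_relations "T_gen m :: 'k free_algebra set" m
  proof
    show "T_ideal (T_gen m :: 'k free_algebra set)" unfolding T_gen_def by (rule T_ideal_T_ideal_generated)
    show "commutator (commutator (var 1) (var 2)) (var 3) * commutator (commutator (var 4) (var 5)) (var 6) \<in> (T_gen m :: 'k free_algebra set)"
      and "prod_list (map (\<lambda>i. commutator (var (2 * i + 1)) (var (2 * i + 2))) [0..<m + 2]) \<in> (T_gen m :: 'k free_algebra set)"
      unfolding T_gen_def using T_ideal_generated_base by blast+
  qed
  let ?I = "identities ut2_scale (UT2 (Grassmann (2 * m))) :: 'k free_algebra set"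
  have I: "two_sided_ideal ?I" by (rule conjunct1[OF T_ideal_identities[unfolded T_ideal_def]])
  have "g \<in> normal_span V" using g(1) proper_subset_normal_span by blast
  then have "g \<in> fa.span (pair_products V \<union> normal_form ` normal_form_indices m V \<union> T_gen m)"
    by (simp add: normal_span_def)
  then obtain p x t where g_eq: "g = (p + x) + t" and p: "p \<in> fa.span (pair_products V)"
    and x: "x \<in> fa.span (normal_form ` normal_form_indices m V)" and t: "t \<in> fa.span (T_gen m)"
    by (auto simp: fa.span_Un)
  have tT: "t \<in> T_gen m" using t subspace_ideal[OF ideal] by (metis fa.span_eq_iff)
  have px: "p + x \<in> ?I"
    using ideal_diff[OF I g(2), of t] tT T_gen_identities by (auto simp: g_eq)
  obtain c where c: "x = (\<Sum>q\<in>normal_form_indices m V. fa_scale (c q) (normal_form q))"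
    by (rule span_image_representation[OF finite_normal_form_indices[OF V] x])
  have "c q = 0" if "q \<in> normal_form_indices m V" for q
    by (rule normal_form_coefficients_zero[OF V p px[unfolded c] that])
  then have "x = 0" unfolding c by simp
  then have "p \<in> ?I" using px by simp
  then have "p \<in> commutator_identities m"
    using pair_products_identity[OF p] by (simp add: commutator_identities_def)
  then show ?thesis using that[of p t] tT g_eq \<open>x = 0\<close> by simp
qed

theorem theorem13:
  fixes m :: nat
  assumes "m \<ge> 1"
  shows "identities (ut2_scale :: 'k::field_char_0 \<Rightarrow> 'k grassmann ut2 \<Rightarrow> 'k grassmann ut2)
           (UT2 (Grassmann (2 * m)))
         = T_ideal_generated (T_gen m \<union> commutator_identities m)"
proof
  let ?I = "identities (ut2_scale :: 'k \<Rightarrow> 'k grassmann ut2 \<Rightarrow> 'k grassmann ut2) (UT2 (Grassmann (2 * m)))"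
  let ?J = "T_ideal_generated (T_gen m \<union> commutator_identities m) :: 'k free_algebra set"
  have I: "T_ideal ?I" by (rule T_ideal_identities)
  have J: "T_ideal ?J" by (rule T_ideal_T_ideal_generated)
  show "?J \<subseteq> ?I"
    using T_gen_identities
    by (intro T_ideal_generated_minimal I) (auto simp: commutator_identities_def)
  have proper: "g \<in> ?J" if V: "finite V" and g: "g \<in> ?I" "g \<in> proper V" for V g
  proof -
    obtain p t where pt: "g = p + t" "p \<in> commutator_identities m" "t \<in> T_gen m"
      by (rule proper_identity[OF V g(2,1)])
    have "T_gen m \<union> commutator_identities m \<subseteq> ?J" by (rule T_ideal_generated_base)
    then have "p \<in> ?J" "t \<in> ?J" using pt by auto
    then show ?thesis unfolding pt(1) using J by (simp add: T_ideal_def ideal_add)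
  qed
  show "?I \<subseteq> ?J"
  proof
    fix f assume "f \<in> ?I"
    then show "f \<in> ?J"
    proof (rule multilinearization[OF I J, rotated])
      fix W and f :: "'k free_algebra" assume f: "finite W" "f \<in> ?I" "multilinear_in W f"
      show "f \<in> ?J"
      proof (rule proper_reduction[OF I J _ f])
        show "g \<in> ?J" if "finite V" "g \<in> ?I" "g \<in> proper V" for V g
          using that by (rule proper)
      qed
    qed
  qed
qed

end
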